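(* For every $\ell\in\mathbb N$ the projective closures in $\mathbb{CP}^3$ of the determinantal surfaces $S_{\ell,\pm}\subset\mathbb C^3\subset\mathbb{CP}^3$ are rational surfaces.
   Context: $\mathbb N=\{1,2,3,\dots\}$. $G_{1,\ell}$ and $G_{2,\ell}$ are the $(\ell+1)\times(\ell+1)$-matrices depending on $(\chi,a,s)\in\mathbb C^3$ with the following entries: for $1\le j\le \ell$: $(G_{1,\ell})_{j,j}=\frac s2$, $(G_{1,\ell})_{j,j+1}=\chi a-j$, $(G_{2,\ell})_{j,\ell+1-j}=\frac a2$, $(G_{2,\ell})_{j,\ell+2-j}=\chi s$; $(G_{1,\ell})_{\ell+1,\ell+1}=\frac12$, $(G_{2,\ell})_{\ell+1,1}=\chi$; all other entries are zero. The determinantal surfaces are $S_{\ell,\pm}=\{\det(G_{1,\ell}\pm G_{2,\ell})=0\}\subset\mathbb C^3_{\chi,a,s}$. *)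

theory Defs
  imports "Jordan_Normal_Form.Determinant"
begin

text \<open>
  The point of \<open>CP n\<close> with homogeneous coordinates \<open>v\<close> is the line spanned by \<open>v\<close>; all index sets
  of coordinates and matrices of the library are 0-based.
\<close>

definition hpoint :: "complex vec \<Rightarrow> complex vec set" where
  "hpoint v = {c \<cdot>\<^sub>v v | c. True}"

definition nonzero_vec :: "nat \<Rightarrow> complex vec set" where
  "nonzero_vec n = carrier_vec (Suc n) - {0\<^sub>v (Suc n)}"

definition CP :: "nat \<Rightarrow> complex vec set set" where
  "CP n = hpoint ` nonzero_vec n"

text \<open>
  Homogeneous polynomials of degree \<open>d\<close> in \<open>x\<^sub>0, \<dots>, x\<^sub>n\<close>, as functions on \<open>\<complex>\<^sup>n\<^sup>+\<^sup>1\<close>. An exponent vector is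
  a function \<open>\<alpha>\<close>, of which only the values on \<open>{..n}\<close> matter. The zero polynomial (empty \<open>A\<close>) has
  every degree.
\<close>

definition form :: "nat \<Rightarrow> nat \<Rightarrow> (complex vec \<Rightarrow> complex) \<Rightarrow> bool" where
  "form n d F \<longleftrightarrow> (\<exists>(A :: (nat \<Rightarrow> nat) set) (c :: (nat \<Rightarrow> nat) \<Rightarrow> complex).
     finite A \<and> (\<forall>\<alpha>\<in>A. (\<Sum>i\<le>n. \<alpha> i) = d) \<and>
     (\<forall>x\<in>carrier_vec (Suc n). F x = (\<Sum>\<alpha>\<in>A. c \<alpha> * (\<Prod>i\<le>n. (x $ i) ^ \<alpha> i))))"

definition zero_locus :: "nat \<Rightarrow> (complex vec \<Rightarrow> complex) set \<Rightarrow> complex vec set set" where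
  "zero_locus n T = {hpoint v | v. v \<in> nonzero_vec n \<and> (\<forall>F\<in>T. F v = 0)}"

definition proj_closed :: "nat \<Rightarrow> complex vec set set \<Rightarrow> bool" where
  "proj_closed n Z \<longleftrightarrow> (\<exists>T. (\<forall>F\<in>T. \<exists>d. form n d F) \<and> Z = zero_locus n T)"

definition zariski_closure :: "nat \<Rightarrow> complex vec set set \<Rightarrow> complex vec set set" where
  "zariski_closure n X = \<Inter>{Z. proj_closed n Z \<and> X \<subseteq> Z}"

definition proj_variety :: "nat \<Rightarrow> complex vec set set \<Rightarrow> bool" where
  "proj_variety n X \<longleftrightarrow> proj_closed n X \<and> X \<noteq> {} \<and>
     (\<forall>Y Z. proj_closed n Y \<and> proj_closed n Z \<and> X = Y \<union> Z \<longrightarrow> X = Y \<or> X = Z)"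

text \<open>
  A rational map from a variety \<open>X \<subseteq> CP n\<close> to \<open>Y \<subseteq> CP m\<close> is represented by an \<open>(m+1)\<close>-tuple \<open>\<Phi>\<close> of
  forms of equal degree that do not all vanish on \<open>X\<close>. The representative is undefined where all
  components vanish; two representatives give the same rational map iff they agree wherever both
  are defined.
\<close>

definition represents_rational_map ::
  "nat \<Rightarrow> complex vec set set \<Rightarrow> nat \<Rightarrow> complex vec set set \<Rightarrow> (complex vec \<Rightarrow> complex vec) \<Rightarrow> bool" where
  "represents_rational_map n X m Y \<Phi> \<longleftrightarrow>
     (\<exists>d. \<forall>i\<le>m. form n d (\<lambda>v. \<Phi> v $ i)) \<and>
     (\<forall>v\<in>carrier_vec (Suc n). \<Phi> v \<in> carrier_vec (Suc m)) \<and>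
     (\<exists>v\<in>nonzero_vec n. hpoint v \<in> X \<and> \<Phi> v \<in> nonzero_vec m) \<and>
     (\<forall>v\<in>nonzero_vec n. hpoint v \<in> X \<and> \<Phi> v \<in> nonzero_vec m \<longrightarrow> hpoint (\<Phi> v) \<in> Y)"

text \<open>The composite \<open>\<Psi> \<circ> \<Phi>\<close> is defined as a rational map on \<open>X\<close> and equals the identity of \<open>X\<close>.\<close>

definition rational_left_inverse ::
  "nat \<Rightarrow> complex vec set set \<Rightarrow> nat \<Rightarrow> (complex vec \<Rightarrow> complex vec) \<Rightarrow> (complex vec \<Rightarrow> complex vec) \<Rightarrow> bool"
  where
  "rational_left_inverse n X m \<Psi> \<Phi> \<longleftrightarrow>
     (\<exists>v\<in>nonzero_vec n. hpoint v \<in> X \<and> \<Phi> v \<in> nonzero_vec m \<and> \<Psi> (\<Phi> v) \<in> nonzero_vec n) \<and>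
     (\<forall>v\<in>nonzero_vec n. hpoint v \<in> X \<and> \<Phi> v \<in> nonzero_vec m \<and> \<Psi> (\<Phi> v) \<in> nonzero_vec n
        \<longrightarrow> hpoint (\<Psi> (\<Phi> v)) = hpoint v)"

definition birational :: "nat \<Rightarrow> complex vec set set \<Rightarrow> nat \<Rightarrow> complex vec set set \<Rightarrow> bool" where
  "birational n X m Y \<longleftrightarrow> (\<exists>\<Phi> \<Psi>.
     represents_rational_map n X m Y \<Phi> \<and> represents_rational_map m Y n X \<Psi> \<and>
     rational_left_inverse n X m \<Psi> \<Phi> \<and> rational_left_inverse m Y n \<Phi> \<Psi>)"

definition rational_surface :: "nat \<Rightarrow> complex vec set set \<Rightarrow> bool" where
  "rational_surface n X \<longleftrightarrow> proj_variety n X \<and> birational n X 2 (CP 2)"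

text \<open>Entries of the two matrices, with the 1-based indices \<open>1 \<le> j, k \<le> l + 1\<close>.\<close>

definition G1_entry :: "nat \<Rightarrow> complex \<Rightarrow> complex \<Rightarrow> complex \<Rightarrow> nat \<Rightarrow> nat \<Rightarrow> complex" where
  "G1_entry l \<chi> a s j k =
     (if j \<le> l \<and> k = j then s / 2
      else if j \<le> l \<and> k = j + 1 then \<chi> * a - of_nat j
      else if j = l + 1 \<and> k = l + 1 then 1 / 2
      else 0)"

definition G2_entry :: "nat \<Rightarrow> complex \<Rightarrow> complex \<Rightarrow> complex \<Rightarrow> nat \<Rightarrow> nat \<Rightarrow> complex" where
  "G2_entry l \<chi> a s j k =
     (if j \<le> l \<and> k = l + 1 - j then a / 2
      else if j \<le> l \<and> k = l + 2 - j then \<chi> * s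
      else if j = l + 1 \<and> k = 1 then \<chi>
      else 0)"

definition G1 :: "nat \<Rightarrow> complex \<Rightarrow> complex \<Rightarrow> complex \<Rightarrow> complex mat" where
  "G1 l \<chi> a s = mat (l + 1) (l + 1) (\<lambda>(j, k). G1_entry l \<chi> a s (j + 1) (k + 1))"

definition G2 :: "nat \<Rightarrow> complex \<Rightarrow> complex \<Rightarrow> complex \<Rightarrow> complex mat" where
  "G2 l \<chi> a s = mat (l + 1) (l + 1) (\<lambda>(j, k). G2_entry l \<chi> a s (j + 1) (k + 1))"

definition S_plus :: "nat \<Rightarrow> (complex \<times> complex \<times> complex) set" where
  "S_plus l = {(\<chi>, a, s). det (G1 l \<chi> a s + G2 l \<chi> a s) = 0}"

definition S_minus :: "nat \<Rightarrow> (complex \<times> complex \<times> complex) set" where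
  "S_minus l = {(\<chi>, a, s). det (G1 l \<chi> a s - G2 l \<chi> a s) = 0}"

definition affine_embedding :: "complex \<times> complex \<times> complex \<Rightarrow> complex vec set" where
  "affine_embedding = (\<lambda>(\<chi>, a, s). hpoint (vec_of_list [1, \<chi>, a, s]))"

definition projective_closure ::
  "(complex \<times> complex \<times> complex) set \<Rightarrow> complex vec set set" where
  "projective_closure S = zariski_closure 3 (affine_embedding ` S)"

end

theory Submission
  imports "HOL-Complex_Analysis.Great_Picard" Defs
begin

text \<open>
  A kernel vector of \<open>G\<^sub>1 \<plusminus> G\<^sub>2\<close> is a polynomial solution of a linear system on the sphere, and a Schlesinger
  transformation lowers the degree of the solution by one. It maps the surface of level \<open>l\<close> birationally to
  that of level \<open>l - 1\<close> by
  \<open>(\<chi>, a, s) \<mapsto> ((a / 2 + 2 l \<chi> / (1 - 4 \<chi>\<^sup>2)) / s, - 2 \<chi> s, s)\<close>. Along the chain of these maps \<open>w\<^sub>k = 2 \<chi>\<^sub>k\<close>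
  satisfies \<open>w\<^sub>k\<^sub>+\<^sub>1 + w\<^sub>k\<^sub>-\<^sub>1 = 2 k w\<^sub>k / (s (1 - w\<^sub>k\<^sup>2))\<close>, and level 0 is the plane \<open>w\<^sub>0 = \<minusplus>1\<close>; so \<open>(w\<^sub>1, s)\<close>
  are birational coordinates on the part of the surface where no denominator vanishes. That part is
  dense: by the maps, it suffices that points with \<open>s \<noteq> 0\<close> and \<open>4 \<chi>\<^sup>2 \<noteq> 1\<close> are dense at each level, which
  follows from Hurwitz's theorem, because for no \<open>(\<chi>, s)\<close> does the determinant vanish for all \<open>a\<close>.
\<close>

text \<open>No closed form of the determinant is used, and its irreducibility is not shown
  algebraically: irreducibility of the closure and the two rational maps all come from one
  parametrization with dense image. So density is the real obstacle. It would fail if the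
  determinant had a factor such as \<open>s\<close> or \<open>1 - 4 \<chi>^2\<close>, whose zero set
  the transformations do not reach; but such a factor would make the determinant vanish for all
  \<open>a\<close> over some (\<chi>, s). Density is proved in the Euclidean topology, where
  Hurwitz's theorem is available; this is enough because forms are continuous. The exceptional value
  4 \<chi>^2 = 1 arises because the new kernel vector is f + 2 \<chi> R f with R the signed reversal
  of coefficients. Since R^2 = 1, the operator 1 - 2 \<chi> R inverts this up to the factor 1 - 4
  \<chi>^2. Division by s comes from solving the last equation of the new system for the new \<chi>.
  Both surfaces are treated at once by a sign \<sigma>, of which the transformations use only
  \<sigma>^2 = 1.\<close>

unbundle no vec_syntax

section \<open>Forms\<close>

text \<open>Terms may be indexed by any finite set and exponent vectors may repeat; equal ones are
  merged here once, so that sums and products can be indexed by disjoint unions and pairs.\<close>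

lemma formI:
  fixes e :: "'i \<Rightarrow> nat \<Rightarrow> nat"
  assumes "finite I" and "\<And>i. i \<in> I \<Longrightarrow> (\<Sum>k\<le>n. e i k) = d"
    and "\<And>x. x \<in> carrier_vec (Suc n) \<Longrightarrow> F x = (\<Sum>i\<in>I. c i * (\<Prod>k\<le>n. (x $ k) ^ e i k))"
  shows "form n d F"
  unfolding form_def
proof (intro exI conjI ballI)
  show "finite (e ` I)" using assms(1) by simp
  fix x :: "complex vec" assume x: "x \<in> carrier_vec (Suc n)"
  have "F x = (\<Sum>\<alpha>\<in>e ` I. \<Sum>i\<in>{i \<in> I. e i = \<alpha>}. c i * (\<Prod>k\<le>n. (x $ k) ^ e i k))"
    unfolding assms(3)[OF x] by (rule sum.image_gen[OF assms(1)])
  also have "\<dots> = (\<Sum>\<alpha>\<in>e ` I. (\<Sum>i\<in>{i \<in> I. e i = \<alpha>}. c i) * (\<Prod>k\<le>n. (x $ k) ^ \<alpha> k))"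
    by (intro sum.cong refl) (simp add: sum_distrib_right)
  finally show "F x = (\<Sum>\<alpha>\<in>e ` I. (\<Sum>i\<in>{i \<in> I. e i = \<alpha>}. c i) * (\<Prod>k\<le>n. (x $ k) ^ \<alpha> k))" .
qed (use assms(2) in auto)

lemma formE:
  assumes "form n d F"
  obtains A c where "finite A" "\<And>\<alpha>. \<alpha> \<in> A \<Longrightarrow> (\<Sum>i\<le>n. \<alpha> i) = d"
    "\<And>x. x \<in> carrier_vec (Suc n) \<Longrightarrow> F x = (\<Sum>\<alpha>\<in>A. c \<alpha> * (\<Prod>i\<le>n. (x $ i) ^ \<alpha> i))"
  using assms unfolding form_def by blast

lemma form_cong:
  assumes "form n d F" "\<And>x. x \<in> carrier_vec (Suc n) \<Longrightarrow> F x = G x"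
  shows "form n d G"
  using assms(1) unfolding form_def by (simp add: assms(2) cong: ball_cong)

lemma form_zero: "form n d (\<lambda>x. 0)"
  by (rule formI[where I = "{}"]) auto

lemma form_const: "form n 0 (\<lambda>x. c)"
  by (rule formI[where I = "{()}" and e = "\<lambda>_ _. 0" and c = "\<lambda>_. c"]) auto

lemma form_coord:
  assumes "k \<le> n"
  shows "form n 1 (\<lambda>x. x $ k)"
proof (rule formI[where I = "{()}" and e = "\<lambda>_ i. if i = k then 1 else 0" and c = "\<lambda>_. 1"])
  fix x :: "complex vec"
  have "(\<Prod>i\<le>n. x $ i ^ (if i = k then 1 else 0)) = (\<Prod>i\<le>n. if i = k then x $ i else 1)"
    by (intro prod.cong) auto
  then show "x $ k = (\<Sum>_\<in>{()}. 1 * (\<Prod>i\<le>n. x $ i ^ (if i = k then 1 else 0)))"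
    using assms by simp
qed (use assms in auto)

lemma form_add:
  assumes "form n d F" "form n d G"
  shows "form n d (\<lambda>x. F x + G x)"
proof -
  obtain A a where A: "finite A" "\<And>\<alpha>. \<alpha> \<in> A \<Longrightarrow> (\<Sum>i\<le>n. \<alpha> i) = d"
    "\<And>x. x \<in> carrier_vec (Suc n) \<Longrightarrow> F x = (\<Sum>\<alpha>\<in>A. a \<alpha> * (\<Prod>i\<le>n. (x $ i) ^ \<alpha> i))"
    using formE[OF assms(1)] by metis
  obtain B b where B: "finite B" "\<And>\<alpha>. \<alpha> \<in> B \<Longrightarrow> (\<Sum>i\<le>n. \<alpha> i) = d"
    "\<And>x. x \<in> carrier_vec (Suc n) \<Longrightarrow> G x = (\<Sum>\<alpha>\<in>B. b \<alpha> * (\<Prod>i\<le>n. (x $ i) ^ \<alpha> i))"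
    using formE[OF assms(2)] by metis
  show ?thesis
    by (rule formI[where I = "A <+> B" and e = "case_sum id id" and c = "case_sum a b"])
       (use A B in \<open>auto simp: sum.Plus\<close>)
qed

lemma form_mult:
  assumes "form n d F" "form n e G"
  shows "form n (d + e) (\<lambda>x. F x * G x)"
proof -
  obtain A a where A: "finite A" "\<And>\<alpha>. \<alpha> \<in> A \<Longrightarrow> (\<Sum>i\<le>n. \<alpha> i) = d"
    "\<And>x. x \<in> carrier_vec (Suc n) \<Longrightarrow> F x = (\<Sum>\<alpha>\<in>A. a \<alpha> * (\<Prod>i\<le>n. (x $ i) ^ \<alpha> i))"
    using formE[OF assms(1)] by metis
  obtain B b where B: "finite B" "\<And>\<alpha>. \<alpha> \<in> B \<Longrightarrow> (\<Sum>i\<le>n. \<alpha> i) = e"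
    "\<And>x. x \<in> carrier_vec (Suc n) \<Longrightarrow> G x = (\<Sum>\<alpha>\<in>B. b \<alpha> * (\<Prod>i\<le>n. (x $ i) ^ \<alpha> i))"
    using formE[OF assms(2)] by metis
  show ?thesis
  proof (rule formI[where I = "A \<times> B" and e = "\<lambda>(\<alpha>, \<beta>) i. \<alpha> i + \<beta> i" and c = "\<lambda>(\<alpha>, \<beta>). a \<alpha> * b \<beta>"])
    fix x :: "complex vec" assume x: "x \<in> carrier_vec (Suc n)"
    show "F x * G x = (\<Sum>i\<in>A \<times> B. (case i of (\<alpha>, \<beta>) \<Rightarrow> a \<alpha> * b \<beta>) *
       (\<Prod>k\<le>n. x $ k ^ (case i of (\<alpha>, \<beta>) \<Rightarrow> \<lambda>i. \<alpha> i + \<beta> i) k))"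
      unfolding A(3)[OF x] B(3)[OF x] sum_product sum.cartesian_product
      by (intro sum.cong) (auto simp: power_add prod.distrib)
  qed (use A B in \<open>auto simp: sum.distrib\<close>)
qed

lemma form_cmult: "form n d F \<Longrightarrow> form n d (\<lambda>x. c * F x)"
  using form_mult[OF form_const] by fastforce

lemma form_uminus: "form n d F \<Longrightarrow> form n d (\<lambda>x. - F x)"
  using form_cmult[of n d F "-1"] by simp

lemma form_diff: "form n d F \<Longrightarrow> form n d G \<Longrightarrow> form n d (\<lambda>x. F x - G x)"
  using form_add[OF _ form_uminus, of n d F G] by simp

lemma form_sum:
  assumes "\<And>i. i \<in> I \<Longrightarrow> form n d (F i)"
  shows "form n d (\<lambda>x. \<Sum>i\<in>I. F i x)"
  using assms by (induction I rule: infinite_finite_induct) (auto intro: form_zero form_add)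

lemma form_power: "form n d F \<Longrightarrow> form n (k * d) (\<lambda>x. F x ^ k)"
  by (induction k) (auto intro: form_const form_mult)

lemma form_prod:
  assumes "finite I" "\<And>i. i \<in> I \<Longrightarrow> form n (d i) (F i)"
  shows "form n (\<Sum>i\<in>I. d i) (\<lambda>x. \<Prod>i\<in>I. F i x)"
  using assms by (induction I rule: finite_induct) (auto intro: form_const form_mult)

lemma form_compose:
  assumes "form m d F" and "\<And>i. i \<le> m \<Longrightarrow> form n e (\<lambda>v. \<Phi> v $ i)"
    and "\<And>v. v \<in> carrier_vec (Suc n) \<Longrightarrow> \<Phi> v \<in> carrier_vec (Suc m)"
  shows "form n (d * e) (\<lambda>v. F (\<Phi> v))"
proof -
  obtain A a where A: "finite A" "\<And>\<alpha>. \<alpha> \<in> A \<Longrightarrow> (\<Sum>i\<le>m. \<alpha> i) = d"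
    "\<And>x. x \<in> carrier_vec (Suc m) \<Longrightarrow> F x = (\<Sum>\<alpha>\<in>A. a \<alpha> * (\<Prod>i\<le>m. (x $ i) ^ \<alpha> i))"
    using formE[OF assms(1)] by metis
  have "form n (d * e) (\<lambda>v. \<Sum>\<alpha>\<in>A. a \<alpha> * (\<Prod>i\<le>m. (\<Phi> v $ i) ^ \<alpha> i))"
  proof (intro form_sum form_cmult)
    fix \<alpha> assume "\<alpha> \<in> A"
    then have "d * e = (\<Sum>i\<le>m. \<alpha> i * e)"
      using A(2)[of \<alpha>] by (simp flip: sum_distrib_right)
    then show "form n (d * e) (\<lambda>v. \<Prod>i\<le>m. (\<Phi> v $ i) ^ \<alpha> i)"
      using assms(2) by (auto intro!: form_prod form_power)
  qed
  then show ?thesis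
    by (rule form_cong) (use A(3) assms(3) in auto)
qed

lemma form_smult_vec:
  assumes "form n d F" "v \<in> carrier_vec (Suc n)"
  shows "F (c \<cdot>\<^sub>v v) = c ^ d * F v"
proof -
  obtain A a where A: "finite A" "\<And>\<alpha>. \<alpha> \<in> A \<Longrightarrow> (\<Sum>i\<le>n. \<alpha> i) = d"
    "\<And>x. x \<in> carrier_vec (Suc n) \<Longrightarrow> F x = (\<Sum>\<alpha>\<in>A. a \<alpha> * (\<Prod>i\<le>n. (x $ i) ^ \<alpha> i))"
    using formE[OF assms(1)] by metis
  have "(\<Prod>i\<le>n. ((c \<cdot>\<^sub>v v) $ i) ^ \<alpha> i) = c ^ d * (\<Prod>i\<le>n. (v $ i) ^ \<alpha> i)" if "\<alpha> \<in> A" for \<alpha>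
  proof -
    have "(\<Prod>i\<le>n. ((c \<cdot>\<^sub>v v) $ i) ^ \<alpha> i) = (\<Prod>i\<le>n. c ^ \<alpha> i * (v $ i) ^ \<alpha> i)"
      using assms(2) by (intro prod.cong) (auto simp: power_mult_distrib)
    then show ?thesis
      using A(2)[OF that] by (simp add: prod.distrib power_sum[symmetric])
  qed
  then show ?thesis
    using assms(2) A(3)[of v] A(3)[of "c \<cdot>\<^sub>v v"] by (simp add: sum_distrib_left mult.left_commute)
qed

section \<open>Integrality and continuity of forms\<close>

lemma form_on_line:
  assumes "form n d F"
  shows "\<exists>p. \<forall>t. F (Matrix.vec (Suc n) (\<lambda>i. f i + t * g i)) = poly p t"
proof -
  obtain A a where A: "finite A" "\<And>\<alpha>. \<alpha> \<in> A \<Longrightarrow> (\<Sum>i\<le>n. \<alpha> i) = d"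
    "\<And>x. x \<in> carrier_vec (Suc n) \<Longrightarrow> F x = (\<Sum>\<alpha>\<in>A. a \<alpha> * (\<Prod>i\<le>n. (x $ i) ^ \<alpha> i))"
    using formE[OF assms(1)] by metis
  show ?thesis
    by (intro exI[of _ "\<Sum>\<alpha>\<in>A. Polynomial.smult (a \<alpha>) (\<Prod>i\<le>n. [:f i, g i:] ^ \<alpha> i)"])
       (simp add: A(3) poly_sum poly_prod less_Suc_eq_le)
qed

text \<open>On the line through \<open>x\<close> and \<open>y\<close> both forms become polynomials
  in one variable. Their product has every complex number as a root, so one factor is zero, and it
  cannot be that of \<open>F\<close>.\<close>

lemma form_mult_eq_0D:
  assumes F: "form n d F" and G: "form n e G"
    and FG: "\<And>x. x \<in> carrier_vec (Suc n) \<Longrightarrow> F x * G x = 0"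
    and x: "x \<in> carrier_vec (Suc n)" "F x \<noteq> 0" and y: "y \<in> carrier_vec (Suc n)"
  shows "G y = 0"
proof (rule ccontr)
  assume Gy: "G y \<noteq> 0"
  define z where "z t = Matrix.vec (Suc n) (\<lambda>i. x $ i + t * (y $ i - x $ i))" for t
  obtain p q where p: "\<And>t. F (z t) = poly p t" and q: "\<And>t. G (z t) = poly q t"
    unfolding z_def using form_on_line[OF F] form_on_line[OF G] by metis
  have z: "z 0 = x" "z 1 = y" using x y by (auto simp: z_def)
  have "poly (p * q) t = 0" for t
    using FG[of "z t"] p[of t] q[of t] by (simp add: z_def)
  then have "p * q = 0" using poly_all_0_iff_0 by blast
  then have "p = 0 \<or> q = 0" by simp
  then show False using p[of 0] q[of 1] z x Gy by auto
qed

lemma continuous_form: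
  fixes g :: "'a::topological_space \<Rightarrow> complex vec"
  assumes "form n d F" "\<And>p. g p \<in> carrier_vec (Suc n)" "\<And>i. i \<le> n \<Longrightarrow> continuous_on UNIV (\<lambda>p. g p $ i)"
  shows "continuous_on UNIV (\<lambda>p. F (g p))"
proof -
  obtain A a where A: "finite A" "\<And>\<alpha>. \<alpha> \<in> A \<Longrightarrow> (\<Sum>i\<le>n. \<alpha> i) = d"
    "\<And>x. x \<in> carrier_vec (Suc n) \<Longrightarrow> F x = (\<Sum>\<alpha>\<in>A. a \<alpha> * (\<Prod>i\<le>n. (x $ i) ^ \<alpha> i))"
    using formE[OF assms(1)] by metis
  show ?thesis
    unfolding A(3)[OF assms(2)] by (intro continuous_intros assms(3)) auto
qed

section \<open>Zariski closures and rational parametrizations\<close>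

lemma mem_hpoint: "v \<in> hpoint v"
  unfolding hpoint_def by (auto intro: exI[of _ 1])

lemma hpoint_smult:
  assumes "c \<noteq> 0"
  shows "hpoint (c \<cdot>\<^sub>v v) = hpoint v"
proof
  show "hpoint (c \<cdot>\<^sub>v v) \<subseteq> hpoint v"
    unfolding hpoint_def by (auto simp: smult_smult_assoc)
  show "hpoint v \<subseteq> hpoint (c \<cdot>\<^sub>v v)"
  proof
    fix x assume "x \<in> hpoint v"
    then obtain b where "x = b \<cdot>\<^sub>v v" unfolding hpoint_def by blast
    then have "x = (b / c) \<cdot>\<^sub>v (c \<cdot>\<^sub>v v)" using assms by (simp add: smult_smult_assoc)
    then show "x \<in> hpoint (c \<cdot>\<^sub>v v)" unfolding hpoint_def by blast
  qed
qed

lemma hpoint_eqD: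
  assumes "v \<in> nonzero_vec n" "hpoint v = hpoint w"
  obtains c where "c \<noteq> 0" "v = c \<cdot>\<^sub>v w"
proof -
  obtain c where c: "v = c \<cdot>\<^sub>v w" using mem_hpoint[of v] assms unfolding hpoint_def by auto
  moreover have "c \<noteq> 0"
  proof
    assume "c = 0"
    then have "v = 0\<^sub>v (dim_vec v)" using c by auto
    moreover have "dim_vec v = Suc n" using assms(1) by (auto simp: nonzero_vec_def)
    ultimately have "v = 0\<^sub>v (Suc n)" by metis
    then show False using assms(1) by (simp add: nonzero_vec_def)
  qed
  ultimately show ?thesis using that by blast
qed

lemma nonzero_vec_smult:
  assumes "v \<in> nonzero_vec n" "c \<noteq> 0"
  shows "c \<cdot>\<^sub>v v \<in> nonzero_vec n"
  using assms by (auto simp: nonzero_vec_def vec_eq_iff)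

text \<open>Equality of two points becomes the vanishing of forms, and so passes from a dense set to
  its closure.\<close>

lemma hpoint_eq_of_minors:
  assumes x: "x \<in> nonzero_vec n" and v: "v \<in> nonzero_vec n"
    and minors: "\<And>i j. i \<le> n \<Longrightarrow> j \<le> n \<Longrightarrow> x $ i * v $ j - x $ j * v $ i = 0"
  shows "hpoint x = hpoint v"
proof -
  obtain j where j: "j \<le> n" "v $ j \<noteq> 0"
    using v by (auto simp: nonzero_vec_def vec_eq_iff less_Suc_eq_le)
  have eq: "x = (x $ j / v $ j) \<cdot>\<^sub>v v"
  proof (rule eq_vecI)
    fix i assume "i < dim_vec ((x $ j / v $ j) \<cdot>\<^sub>v v)"
    then have "i \<le> n" "i < dim_vec v" using v by (auto simp: nonzero_vec_def)
    then show "x $ i = ((x $ j / v $ j) \<cdot>\<^sub>v v) $ i"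
      using minors[of i j] j by (simp add: field_simps)
  qed (use x v in \<open>auto simp: nonzero_vec_def\<close>)
  have "x $ j / v $ j \<noteq> 0"
  proof
    assume "x $ j / v $ j = 0"
    then have "x = 0 \<cdot>\<^sub>v v" using eq by metis
    then show False using x v by (auto simp: nonzero_vec_def)
  qed
  then show ?thesis using eq hpoint_smult by metis
qed

text \<open>\<open>zero_locus\<close> only asks for some representative; by homogeneity any
  representative decides.\<close>

lemma hpoint_mem_zero_locus:
  assumes T: "\<And>F. F \<in> T \<Longrightarrow> \<exists>d. form n d F" and v: "v \<in> nonzero_vec n"
  shows "hpoint v \<in> zero_locus n T \<longleftrightarrow> (\<forall>F\<in>T. F v = 0)"
proof
  assume "hpoint v \<in> zero_locus n T"
  then obtain w where w: "w \<in> nonzero_vec n" "hpoint v = hpoint w" "\<forall>F\<in>T. F w = 0"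
    unfolding zero_locus_def by auto
  obtain c where "v = c \<cdot>\<^sub>v w" using hpoint_eqD[OF v w(2)] by blast
  then have "F v = 0" if "F \<in> T" for F
    using w T[OF that] form_smult_vec[of n _ F w c] that by (auto simp: nonzero_vec_def)
  then show "\<forall>F\<in>T. F v = 0" by blast
qed (use v in \<open>auto simp: zero_locus_def\<close>)

lemma zariski_closure_hpoints:
  assumes V: "V \<subseteq> nonzero_vec n"
  shows "zariski_closure n (hpoint ` V) = zero_locus n {F. (\<exists>d. form n d F) \<and> (\<forall>v\<in>V. F v = 0)}"
    (is "_ = zero_locus n ?T")
proof
  have "proj_closed n (zero_locus n ?T)"
    unfolding proj_closed_def by (intro exI[of _ ?T]) simp
  moreover have "hpoint ` V \<subseteq> zero_locus n ?T"
  proof (rule image_subsetI)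
    fix v assume "v \<in> V"
    then have "v \<in> nonzero_vec n \<and> (\<forall>F\<in>?T. F v = 0)" using V by blast
    then show "hpoint v \<in> zero_locus n ?T" unfolding zero_locus_def by blast
  qed
  ultimately show "zariski_closure n (hpoint ` V) \<subseteq> zero_locus n ?T"
    unfolding zariski_closure_def by blast
  show "zero_locus n ?T \<subseteq> zariski_closure n (hpoint ` V)"
    unfolding zariski_closure_def
  proof (intro Inter_greatest, clarify)
    fix x Z assume x: "x \<in> zero_locus n ?T" and Z: "proj_closed n Z" "hpoint ` V \<subseteq> Z"
    obtain T where T: "\<And>F. F \<in> T \<Longrightarrow> \<exists>d. form n d F" "Z = zero_locus n T"
      using Z(1) unfolding proj_closed_def by blast
    have "T \<subseteq> ?T"
      using T hpoint_mem_zero_locus[OF T(1)] Z(2) V by blast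
    then show "x \<in> Z" using x unfolding T(2) zero_locus_def by blast
  qed
qed

text \<open>The set \<open>U\<close> parametrizes a Zariski-dense set of points \<xi> u of the plane
  and points \<eta> u of the surface, and the tuples \<Phi>, \<Psi> exchange them up to scalars. A
  form on the ambient space is pulled back along \<Psi> to the plane, where vanishing on
  \<open>U\<close> means vanishing everywhere. This gives irreducibility, since forms in the plane
  have no zero divisors, and it puts the image of \<Psi> in the closure. The composites are the
  identity because the minors expressing this vanish at the parametrized points.\<close>

lemma rational_surface_of_param:
  fixes \<xi> \<eta> :: "'u \<Rightarrow> complex vec"
  assumes U: "U \<noteq> {}"
    and \<xi>: "\<And>u. u \<in> U \<Longrightarrow> \<xi> u \<in> nonzero_vec 2" and \<eta>: "\<And>u. u \<in> U \<Longrightarrow> \<eta> u \<in> nonzero_vec n"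
    and dense: "\<And>d F v. form 2 d F \<Longrightarrow> (\<And>u. u \<in> U \<Longrightarrow> F (\<xi> u) = 0) \<Longrightarrow> v \<in> carrier_vec (Suc 2) \<Longrightarrow> F v = 0"
    and \<Phi>: "\<And>i. i \<le> 2 \<Longrightarrow> form n d (\<lambda>v. \<Phi> v $ i)" "\<And>v. \<Phi> v \<in> carrier_vec (Suc 2)"
      "\<And>u. u \<in> U \<Longrightarrow> \<exists>c. c \<noteq> 0 \<and> \<Phi> (\<eta> u) = c \<cdot>\<^sub>v \<xi> u"
    and \<Psi>: "\<And>i. i \<le> n \<Longrightarrow> form 2 e (\<lambda>v. \<Psi> v $ i)" "\<And>v. \<Psi> v \<in> carrier_vec (Suc n)"
      "\<And>u. u \<in> U \<Longrightarrow> \<exists>c. c \<noteq> 0 \<and> \<Psi> (\<xi> u) = c \<cdot>\<^sub>v \<eta> u"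
  shows "rational_surface n (zariski_closure n (hpoint ` \<eta> ` U))"
proof -
  define X where "X = zariski_closure n (hpoint ` \<eta> ` U)"
  define T where "T = {F. (\<exists>d. form n d F) \<and> (\<forall>v\<in>\<eta> ` U. F v = 0)}"
  have X: "X = zero_locus n T"
    unfolding X_def T_def by (rule zariski_closure_hpoints) (use \<eta> in auto)
  have T_form: "\<exists>d. form n d F" if "F \<in> T" for F using that by (auto simp: T_def)
  have mem_X: "hpoint v \<in> X \<longleftrightarrow> (\<forall>F\<in>T. F v = 0)" if "v \<in> nonzero_vec n" for v
    unfolding X using hpoint_mem_zero_locus[OF T_form that] .
  have \<eta>_X: "hpoint (\<eta> u) \<in> X" if "u \<in> U" for u
    using mem_X[OF \<eta>[OF that]] that by (auto simp: T_def)
  have carr: "\<xi> u \<in> carrier_vec (Suc 2)" "\<eta> u \<in> carrier_vec (Suc n)" if "u \<in> U" for u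
    using \<xi>[OF that] \<eta>[OF that] by (auto simp: nonzero_vec_def)
  have dims: "dim_vec (\<Phi> v) = Suc 2" "dim_vec (\<Psi> v) = Suc n" for v
    using \<Phi>(2) \<Psi>(2) carrier_vecD by blast+
  have pull_form: "form 2 (k * e) (\<lambda>v. F (\<Psi> v))" if "form n k F" for k F
    by (rule form_compose[OF that]) (use \<Psi> in auto)
  have pull_eq: "\<exists>c. c \<noteq> 0 \<and> F (\<Psi> (\<xi> u)) = c * F (\<eta> u)" if F: "form n k F" and u: "u \<in> U" for k F u
  proof -
    obtain c where "c \<noteq> 0" "\<Psi> (\<xi> u) = c \<cdot>\<^sub>v \<eta> u" using \<Psi>(3)[OF u] by blast
    then show ?thesis using form_smult_vec[OF F carr(2)[OF u]] by (intro exI[of _ "c ^ k"]) simp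
  qed
  have \<Psi>\<Phi>: "\<exists>c. c \<noteq> 0 \<and> \<Psi> (\<Phi> (\<eta> u)) = c \<cdot>\<^sub>v \<eta> u" if u: "u \<in> U" for u
  proof -
    obtain c c' where c: "c \<noteq> 0" "\<Phi> (\<eta> u) = c \<cdot>\<^sub>v \<xi> u" "c' \<noteq> 0" "\<Psi> (\<xi> u) = c' \<cdot>\<^sub>v \<eta> u"
      using \<Phi>(3)[OF u] \<Psi>(3)[OF u] by blast
    have "\<Psi> (\<Phi> (\<eta> u)) = c ^ e \<cdot>\<^sub>v \<Psi> (\<xi> u)"
      using form_smult_vec[OF \<Psi>(1) carr(1)[OF u]] c(2)
      by (intro eq_vecI) (auto simp: less_Suc_eq_le dims)
    then show ?thesis using c by (intro exI[of _ "c ^ e * c'"]) (simp add: smult_smult_assoc)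
  qed
  have \<Phi>\<Psi>: "\<exists>c. c \<noteq> 0 \<and> \<Phi> (\<Psi> (\<xi> u)) = c \<cdot>\<^sub>v \<xi> u" if u: "u \<in> U" for u
  proof -
    obtain c c' where c: "c \<noteq> 0" "\<Phi> (\<eta> u) = c \<cdot>\<^sub>v \<xi> u" "c' \<noteq> 0" "\<Psi> (\<xi> u) = c' \<cdot>\<^sub>v \<eta> u"
      using \<Phi>(3)[OF u] \<Psi>(3)[OF u] by blast
    have "\<Phi> (\<Psi> (\<xi> u)) = c' ^ d \<cdot>\<^sub>v \<Phi> (\<eta> u)"
      using form_smult_vec[OF \<Phi>(1) carr(2)[OF u]] c(4)
      by (intro eq_vecI) (auto simp: less_Suc_eq_le dims)
    then show ?thesis using c by (intro exI[of _ "c' ^ d * c"]) (simp add: smult_smult_assoc)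
  qed
  have "proj_variety n X"
    unfolding proj_variety_def
  proof (intro conjI allI impI)
    show "proj_closed n X" unfolding X proj_closed_def using T_form by blast
    show "X \<noteq> {}" using U \<eta>_X by blast
    fix Y Z assume YZ: "proj_closed n Y \<and> proj_closed n Z \<and> X = Y \<union> Z"
    \<comment> \<open>A proper closed subset \<open>W\<close> of \<open>X\<close> is cut out by
      forms, and one of them is nonzero at some parametrized point, since otherwise \<open>W\<close>
      would contain the closure.\<close>
    have separate: "\<exists>F k u. form n k F \<and> u \<in> U \<and> F (\<eta> u) \<noteq> 0 \<and>
        (\<forall>u\<in>U. hpoint (\<eta> u) \<in> W \<longrightarrow> F (\<eta> u) = 0)"
      if W: "proj_closed n W" "W \<subseteq> X" "X \<noteq> W" for W
    proof -
      obtain T' where T': "\<And>F. F \<in> T' \<Longrightarrow> \<exists>d. form n d F" "W = zero_locus n T'"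
        using W(1) unfolding proj_closed_def by blast
      have "\<not> T' \<subseteq> T"
      proof
        assume "T' \<subseteq> T"
        then have "X \<subseteq> W" unfolding X T'(2) zero_locus_def by blast
        then show False using W(2,3) by blast
      qed
      then obtain F where F: "F \<in> T'" "F \<notin> T" by blast
      obtain k where "form n k F" using T'(1)[OF F(1)] by blast
      moreover from this obtain u where "u \<in> U" "F (\<eta> u) \<noteq> 0"
        using F(2) unfolding T_def by blast
      moreover have "F (\<eta> u) = 0" if "u \<in> U" "hpoint (\<eta> u) \<in> W" for u
        using hpoint_mem_zero_locus[OF T'(1) \<eta>[OF that(1)]] that(2) F(1) unfolding T'(2) by blast
      ultimately show ?thesis by blast
    qed
    show "X = Y \<or> X = Z"
    proof (rule ccontr)
      assume "\<not> (X = Y \<or> X = Z)"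
      then obtain F k u G m w where F: "form n k F" "u \<in> U" "F (\<eta> u) \<noteq> 0"
          "\<And>u. u \<in> U \<Longrightarrow> hpoint (\<eta> u) \<in> Y \<Longrightarrow> F (\<eta> u) = 0"
        and G: "form n m G" "w \<in> U" "G (\<eta> w) \<noteq> 0"
          "\<And>u. u \<in> U \<Longrightarrow> hpoint (\<eta> u) \<in> Z \<Longrightarrow> G (\<eta> u) = 0"
        using separate[of Y] separate[of Z] YZ by blast
      \<comment> \<open>Every parametrized point lies in \<open>Y\<close> or in \<open>Z\<close>, so
        one of the two forms vanishes there.\<close>
      have "F (\<Psi> x) * G (\<Psi> x) = 0" if "x \<in> carrier_vec (Suc 2)" for x
      proof (rule dense[OF form_mult[OF pull_form[OF F(1)] pull_form[OF G(1)]] _ that])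
        fix u' assume u': "u' \<in> U"
        then have "F (\<eta> u') = 0 \<or> G (\<eta> u') = 0" using F(4) G(4) \<eta>_X YZ by blast
        then show "F (\<Psi> (\<xi> u')) * G (\<Psi> (\<xi> u')) = 0"
          using pull_eq[OF F(1) u'] pull_eq[OF G(1) u'] by auto
      qed
      moreover have "F (\<Psi> (\<xi> u)) \<noteq> 0" "G (\<Psi> (\<xi> w)) \<noteq> 0"
        using pull_eq[OF F(1,2)] pull_eq[OF G(1,2)] F(3) G(3) by auto
      ultimately show False
        using form_mult_eq_0D[OF pull_form[OF F(1)] pull_form[OF G(1)]] carr F(2) G(2) by blast
    qed
  qed
  moreover have "represents_rational_map n X 2 (CP 2) \<Phi>"
    unfolding represents_rational_map_def
  proof (intro conjI ballI impI)
    obtain u where u: "u \<in> U" using U by blast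
    then have "\<Phi> (\<eta> u) \<in> nonzero_vec 2" using \<Phi>(3) \<xi> nonzero_vec_smult by metis
    then show "\<exists>v\<in>nonzero_vec n. hpoint v \<in> X \<and> \<Phi> v \<in> nonzero_vec 2"
      using \<eta> \<eta>_X u by blast
  qed (use \<Phi> in \<open>auto simp: CP_def\<close>)
  moreover have "represents_rational_map 2 (CP 2) n X \<Psi>"
    unfolding represents_rational_map_def
  proof (intro conjI ballI impI)
    obtain u where u: "u \<in> U" using U by blast
    then have "\<Psi> (\<xi> u) \<in> nonzero_vec n" using \<Psi>(3) \<eta> nonzero_vec_smult by metis
    then show "\<exists>v\<in>nonzero_vec 2. hpoint v \<in> CP 2 \<and> \<Psi> v \<in> nonzero_vec n"
      using \<xi> u by (auto simp: CP_def)
    fix v assume v: "v \<in> nonzero_vec 2" "hpoint v \<in> CP 2 \<and> \<Psi> v \<in> nonzero_vec n"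
    have "F (\<Psi> v) = 0" if "F \<in> T" for F
    proof -
      obtain k where k: "form n k F" using T_form \<open>F \<in> T\<close> by blast
      show ?thesis
      proof (rule dense[OF pull_form[OF k]])
        show "F (\<Psi> (\<xi> u)) = 0" if "u \<in> U" for u
          using pull_eq[OF k that] \<open>F \<in> T\<close> that by (auto simp: T_def)
      qed (use v in \<open>auto simp: nonzero_vec_def\<close>)
    qed
    then show "hpoint (\<Psi> v) \<in> X" using mem_X v by blast
  qed (use \<Psi> in auto)
  moreover have "rational_left_inverse n X 2 \<Psi> \<Phi>"
    unfolding rational_left_inverse_def
  proof (intro conjI ballI impI)
    obtain u where u: "u \<in> U" using U by blast
    have "\<Phi> (\<eta> u) \<in> nonzero_vec 2" "\<Psi> (\<Phi> (\<eta> u)) \<in> nonzero_vec n"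
      using \<Phi>(3)[OF u] \<xi>[OF u] \<Psi>\<Phi>[OF u] \<eta>[OF u] nonzero_vec_smult by metis+
    then show "\<exists>v\<in>nonzero_vec n. hpoint v \<in> X \<and> \<Phi> v \<in> nonzero_vec 2 \<and> \<Psi> (\<Phi> v) \<in> nonzero_vec n"
      using \<eta> \<eta>_X u by blast
    fix v assume v: "v \<in> nonzero_vec n"
      and v': "hpoint v \<in> X \<and> \<Phi> v \<in> nonzero_vec 2 \<and> \<Psi> (\<Phi> v) \<in> nonzero_vec n"
    show "hpoint (\<Psi> (\<Phi> v)) = hpoint v"
    proof (rule hpoint_eq_of_minors[OF _ v])
      fix i j assume ij: "i \<le> n" "j \<le> n"
      define F where "F v = \<Psi> (\<Phi> v) $ i * v $ j - \<Psi> (\<Phi> v) $ j * v $ i" for v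
      have "form n (e * d + 1) F"
        unfolding F_def
        by (intro form_diff form_mult form_coord form_compose[where F = "\<lambda>v. \<Psi> v $ _"]) (use \<Phi> \<Psi> ij in auto)
      moreover have "F (\<eta> u) = 0" if u: "u \<in> U" for u
        using \<Psi>\<Phi>[OF u] ij carr[OF u] by (auto simp: F_def)
      ultimately have "F \<in> T" by (auto simp: T_def)
      then have "F v = 0" using mem_X[OF v] v' by blast
      then show "\<Psi> (\<Phi> v) $ i * v $ j - \<Psi> (\<Phi> v) $ j * v $ i = 0" by (simp add: F_def)
    qed (use v' in blast)
  qed
  moreover have "rational_left_inverse 2 (CP 2) n \<Phi> \<Psi>"
    unfolding rational_left_inverse_def
  proof (intro conjI ballI impI)
    obtain u where u: "u \<in> U" using U by blast
    have "\<Psi> (\<xi> u) \<in> nonzero_vec n" "\<Phi> (\<Psi> (\<xi> u)) \<in> nonzero_vec 2"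
      using \<Psi>(3)[OF u] \<xi>[OF u] \<Phi>\<Psi>[OF u] \<eta>[OF u] nonzero_vec_smult by metis+
    then show "\<exists>v\<in>nonzero_vec 2. hpoint v \<in> CP 2 \<and> \<Psi> v \<in> nonzero_vec n \<and> \<Phi> (\<Psi> v) \<in> nonzero_vec 2"
      using \<xi> u by (auto simp: CP_def)
    fix v assume v: "v \<in> nonzero_vec 2"
      and v': "hpoint v \<in> CP 2 \<and> \<Psi> v \<in> nonzero_vec n \<and> \<Phi> (\<Psi> v) \<in> nonzero_vec 2"
    show "hpoint (\<Phi> (\<Psi> v)) = hpoint v"
    proof (rule hpoint_eq_of_minors[OF _ v])
      fix i j :: nat assume ij: "i \<le> 2" "j \<le> 2"
      define F where "F v = \<Phi> (\<Psi> v) $ i * v $ j - \<Phi> (\<Psi> v) $ j * v $ i" for v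
      have F: "form 2 (d * e + 1) F"
        unfolding F_def
        by (intro form_diff form_mult form_coord form_compose[where F = "\<lambda>v. \<Phi> v $ _"]) (use \<Phi> \<Psi> ij in auto)
      have "F (\<xi> u) = 0" if u: "u \<in> U" for u
        using \<Phi>\<Psi>[OF u] ij carr[OF u] by (auto simp: F_def)
      then have "F v = 0" using dense[OF F] v by (auto simp: nonzero_vec_def)
      then show "\<Phi> (\<Psi> v) $ i * v $ j - \<Phi> (\<Psi> v) $ j * v $ i = 0" by (simp add: F_def)
    qed (use v' in blast)
  qed
  ultimately show ?thesis
    unfolding rational_surface_def birational_def X_def[symmetric] by blast
qed

section \<open>Functions on a parameter set that are quotients of two forms of equal degree\<close>

definition form_ratio :: "nat \<Rightarrow> ('u \<Rightarrow> complex vec) \<Rightarrow> 'u set \<Rightarrow> ('u \<Rightarrow> complex) \<Rightarrow> bool" where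
  "form_ratio n \<iota> U f \<longleftrightarrow>
     (\<exists>d N M. form n d N \<and> form n d M \<and> (\<forall>u\<in>U. M (\<iota> u) \<noteq> 0 \<and> f u = N (\<iota> u) / M (\<iota> u)))"

lemma form_ratioI:
  "form n d N \<Longrightarrow> form n d M \<Longrightarrow> (\<And>u. u \<in> U \<Longrightarrow> M (\<iota> u) \<noteq> 0) \<Longrightarrow>
   (\<And>u. u \<in> U \<Longrightarrow> f u = N (\<iota> u) / M (\<iota> u)) \<Longrightarrow> form_ratio n \<iota> U f"
  unfolding form_ratio_def by blast

lemma form_ratioE:
  assumes "form_ratio n \<iota> U f"
  obtains d N M where "form n d N" "form n d M" "\<And>u. u \<in> U \<Longrightarrow> M (\<iota> u) \<noteq> 0"
    "\<And>u. u \<in> U \<Longrightarrow> f u = N (\<iota> u) / M (\<iota> u)"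
  using assms unfolding form_ratio_def by metis

lemma form_ratio_cong:
  "form_ratio n \<iota> U f \<Longrightarrow> (\<And>u. u \<in> U \<Longrightarrow> f u = g u) \<Longrightarrow> form_ratio n \<iota> U g"
  unfolding form_ratio_def by metis

lemma form_ratio_const: "form_ratio n \<iota> U (\<lambda>_. c)"
  by (rule form_ratioI[OF form_const[of n c] form_const[of n 1]]) auto

lemma form_ratio_coord:
  assumes "i \<le> n" "\<And>u. u \<in> U \<Longrightarrow> \<iota> u $ 0 = 1"
  shows "form_ratio n \<iota> U (\<lambda>u. \<iota> u $ i)"
  by (rule form_ratioI[OF form_coord[of i n] form_coord[of 0 n]]) (use assms in auto)

lemma form_ratio_add:
  assumes "form_ratio n \<iota> U f" "form_ratio n \<iota> U g"
  shows "form_ratio n \<iota> U (\<lambda>u. f u + g u)"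
proof -
  obtain d N M where f: "form n d N" "form n d M" "\<And>u. u \<in> U \<Longrightarrow> M (\<iota> u) \<noteq> 0"
    "\<And>u. u \<in> U \<Longrightarrow> f u = N (\<iota> u) / M (\<iota> u)" using form_ratioE[OF assms(1)] by metis
  obtain e P Q where g: "form n e P" "form n e Q" "\<And>u. u \<in> U \<Longrightarrow> Q (\<iota> u) \<noteq> 0"
    "\<And>u. u \<in> U \<Longrightarrow> g u = P (\<iota> u) / Q (\<iota> u)" using form_ratioE[OF assms(2)] by metis
  have "form n (d + e) (\<lambda>x. N x * Q x + M x * P x)" "form n (d + e) (\<lambda>x. M x * Q x)"
    by (intro form_add form_mult f g)+
  then show ?thesis by (rule form_ratioI) (use f g in \<open>auto simp: field_simps\<close>)
qed

lemma form_ratio_mult: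
  assumes "form_ratio n \<iota> U f" "form_ratio n \<iota> U g"
  shows "form_ratio n \<iota> U (\<lambda>u. f u * g u)"
proof -
  obtain d N M where f: "form n d N" "form n d M" "\<And>u. u \<in> U \<Longrightarrow> M (\<iota> u) \<noteq> 0"
    "\<And>u. u \<in> U \<Longrightarrow> f u = N (\<iota> u) / M (\<iota> u)" using form_ratioE[OF assms(1)] by metis
  obtain e P Q where g: "form n e P" "form n e Q" "\<And>u. u \<in> U \<Longrightarrow> Q (\<iota> u) \<noteq> 0"
    "\<And>u. u \<in> U \<Longrightarrow> g u = P (\<iota> u) / Q (\<iota> u)" using form_ratioE[OF assms(2)] by metis
  show ?thesis
    by (rule form_ratioI[OF form_mult[OF f(1) g(1)] form_mult[OF f(2) g(2)]]) (use f g in auto)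
qed

lemma form_ratio_inverse:
  assumes "form_ratio n \<iota> U f" "\<And>u. u \<in> U \<Longrightarrow> f u \<noteq> 0"
  shows "form_ratio n \<iota> U (\<lambda>u. inverse (f u))"
proof -
  obtain d N M where f: "form n d N" "form n d M" "\<And>u. u \<in> U \<Longrightarrow> M (\<iota> u) \<noteq> 0"
    "\<And>u. u \<in> U \<Longrightarrow> f u = N (\<iota> u) / M (\<iota> u)" using form_ratioE[OF assms(1)] by metis
  show ?thesis
    by (rule form_ratioI[OF f(2,1)]) (use f assms(2) in auto)
qed

lemma form_ratio_uminus: "form_ratio n \<iota> U f \<Longrightarrow> form_ratio n \<iota> U (\<lambda>u. - f u)"
  using form_ratio_mult[OF form_ratio_const[of n \<iota> U "-1"]] by fastforce

lemma form_ratio_diff: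
  "form_ratio n \<iota> U f \<Longrightarrow> form_ratio n \<iota> U g \<Longrightarrow> form_ratio n \<iota> U (\<lambda>u. f u - g u)"
  using form_ratio_add[OF _ form_ratio_uminus, of n \<iota> U f g] by simp

lemma form_ratio_divide:
  "form_ratio n \<iota> U f \<Longrightarrow> form_ratio n \<iota> U g \<Longrightarrow> (\<And>u. u \<in> U \<Longrightarrow> g u \<noteq> 0) \<Longrightarrow>
   form_ratio n \<iota> U (\<lambda>u. f u / g u)"
  unfolding divide_inverse by (intro form_ratio_mult form_ratio_inverse)

lemma form_ratio_power: "form_ratio n \<iota> U f \<Longrightarrow> form_ratio n \<iota> U (\<lambda>u. f u ^ k)"
  by (induction k) (auto intro: form_ratio_const form_ratio_mult)

lemmas form_ratio_intros = form_ratio_const form_ratio_add form_ratio_diff form_ratio_uminus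
  form_ratio_mult form_ratio_divide form_ratio_power

text \<open>Clearing denominators: each numerator is multiplied by all the other denominators.
  Because numerator and denominator have equal degree, every component gets the same total degree,
  and the common scalar is the product of all denominators, which is nonzero on
  \<open>U\<close>.\<close>

lemma form_ratio_tuple:
  assumes "\<And>i. i \<le> m \<Longrightarrow> form_ratio n \<iota> U (f i)"
  shows "\<exists>d \<Phi>. (\<forall>i\<le>m. form n d (\<lambda>v. \<Phi> v $ i)) \<and> (\<forall>v. \<Phi> v \<in> carrier_vec (Suc m)) \<and>
    (\<forall>u\<in>U. \<exists>c. c \<noteq> 0 \<and> \<Phi> (\<iota> u) = c \<cdot>\<^sub>v Matrix.vec (Suc m) (\<lambda>i. f i u))"
proof -
  have "\<forall>i. \<exists>d N M. i \<le> m \<longrightarrow> form n d N \<and> form n d M \<and>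
      (\<forall>u\<in>U. M (\<iota> u) \<noteq> 0 \<and> f i u = N (\<iota> u) / M (\<iota> u))"
    using assms unfolding form_ratio_def by metis
  then obtain d N M where *: "\<And>i. i \<le> m \<Longrightarrow> form n (d i) (N i)" "\<And>i. i \<le> m \<Longrightarrow> form n (d i) (M i)"
      "\<And>i u. i \<le> m \<Longrightarrow> u \<in> U \<Longrightarrow> M i (\<iota> u) \<noteq> 0"
      "\<And>i u. i \<le> m \<Longrightarrow> u \<in> U \<Longrightarrow> f i u = N i (\<iota> u) / M i (\<iota> u)"
    by metis
  define \<Phi> where "\<Phi> v = Matrix.vec (Suc m) (\<lambda>i. N i v * (\<Prod>k\<in>{..m} - {i}. M k v))" for v
  show ?thesis
  proof (intro exI conjI allI impI ballI)
    fix i assume i: "i \<le> m"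
    have "form n (d i + (\<Sum>k\<in>{..m} - {i}. d k)) (\<lambda>v. N i v * (\<Prod>k\<in>{..m} - {i}. M k v))"
      by (intro form_mult form_prod) (use * i in auto)
    also have "d i + (\<Sum>k\<in>{..m} - {i}. d k) = (\<Sum>k\<le>m. d k)"
      using i by (simp add: sum.remove[of _ i])
    finally show "form n (\<Sum>k\<le>m. d k) (\<lambda>v. \<Phi> v $ i)" using i by (simp add: \<Phi>_def)
  next
    fix u assume u: "u \<in> U"
    show "(\<Prod>k\<le>m. M k (\<iota> u)) \<noteq> 0" using *(3) u by simp
    show "\<Phi> (\<iota> u) = (\<Prod>k\<le>m. M k (\<iota> u)) \<cdot>\<^sub>v Matrix.vec (Suc m) (\<lambda>i. f i u)"
    proof (rule eq_vecI)
      fix i assume "i < dim_vec ((\<Prod>k\<le>m. M k (\<iota> u)) \<cdot>\<^sub>v Matrix.vec (Suc m) (\<lambda>i. f i u))"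
      then have i: "i \<le> m" by simp
      then have "(\<Prod>k\<le>m. M k (\<iota> u)) = M i (\<iota> u) * (\<Prod>k\<in>{..m} - {i}. M k (\<iota> u))"
        by (simp add: prod.remove[of _ i])
      then show "\<Phi> (\<iota> u) $ i = ((\<Prod>k\<le>m. M k (\<iota> u)) \<cdot>\<^sub>v Matrix.vec (Suc m) (\<lambda>i. f i u)) $ i"
        using i *(3,4)[OF i u] by (simp add: \<Phi>_def)
    qed (simp add: \<Phi>_def)
  qed (simp add: \<Phi>_def)
qed

section \<open>The determinantal surfaces and their Schlesinger transformations\<close>

definition det_surface :: "complex \<Rightarrow> nat \<Rightarrow> (complex \<times> complex \<times> complex) set" where
  "det_surface \<sigma> l = {(\<chi>, a, s). Determinant.det (G1 l \<chi> a s + \<sigma> \<cdot>\<^sub>m G2 l \<chi> a s) = 0}"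

lemma S_plus_eq: "S_plus l = det_surface 1 l"
proof -
  have "1 \<cdot>\<^sub>m G2 l \<chi> a s = G2 l \<chi> a s" for \<chi> a s
    by (rule eq_matI) auto
  then show ?thesis by (simp add: S_plus_def det_surface_def)
qed

lemma S_minus_eq: "S_minus l = det_surface (-1) l"
proof -
  have "G1 l \<chi> a s - G2 l \<chi> a s = G1 l \<chi> a s + (-1) \<cdot>\<^sub>m G2 l \<chi> a s" for \<chi> a s
    by (rule eq_matI) (auto simp: G1_def G2_def)
  then show ?thesis by (simp add: S_minus_def det_surface_def)
qed

text \<open>
  If the generating polynomial \<open>F\<close> of \<open>f\<close> and its reflection \<open>G = \<sigma> z\<^sup>l F(1/z)\<close> come from the kernel, they
  solve a linear system with irregular singularities at 0 and \<open>\<infinity>\<close>; in terms of \<open>H = F + 2 \<chi> G\<close> and its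
  reflection, the equation for \<open>F\<close> is \<open>F' = s/2 H + a/2 \<sigma> z\<^sup>l\<^sup>-\<^sup>1 H(1/z)\<close>. The coefficients of \<open>H\<close> are \<open>refl_comb \<sigma> l \<chi> f\<close>.
\<close>
definition refl_comb :: "complex \<Rightarrow> nat \<Rightarrow> complex \<Rightarrow> (nat \<Rightarrow> complex) \<Rightarrow> nat \<Rightarrow> complex" where
  "refl_comb \<sigma> l \<chi> f i = f i + 2 * \<chi> * \<sigma> * f (l - i)"

text \<open>With R the signed reversal, (1 - 2 \<chi> R)(1 + 2 \<chi> R) = 1 - 4 \<chi>^2, because
  R^2 = \<sigma>^2 = 1.\<close>

lemma refl_comb_inverse:
  assumes "\<sigma>\<^sup>2 = 1" "j \<le> l"
  shows "(1 - 4 * \<chi>\<^sup>2) * f j = refl_comb \<sigma> l \<chi> f j - 2 * \<chi> * \<sigma> * refl_comb \<sigma> l \<chi> f (l - j)"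
proof -
  have "\<sigma> * \<sigma> = 1" using assms by (simp add: power2_eq_square)
  moreover have "refl_comb \<sigma> l \<chi> f j - 2 * \<chi> * \<sigma> * refl_comb \<sigma> l \<chi> f (l - j)
      = (1 - 4 * \<chi>\<^sup>2) * f j + 4 * \<chi>\<^sup>2 * (1 - \<sigma> * \<sigma>) * f j"
    using assms by (simp add: refl_comb_def algebra_simps power2_eq_square)
  ultimately show ?thesis by simp
qed

text \<open>The kernel equations of the matrix, regrouped: the entries \<open>\<chi> * s\<close>
  complete the \<open>s / 2\<close> term, and the entries \<open>\<chi> * a\<close> complete the
  \<open>a / 2\<close> term because \<sigma>^2 = 1. The first conjunct is twice the last row. Only
  the values of \<open>f\<close> on \<open>{..l}\<close> matter.\<close>

definition kernel_rel :: "complex \<Rightarrow> nat \<Rightarrow> complex \<Rightarrow> complex \<Rightarrow> complex \<Rightarrow> (nat \<Rightarrow> complex) \<Rightarrow> bool" where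
  "kernel_rel \<sigma> l \<chi> a s f \<longleftrightarrow> refl_comb \<sigma> l \<chi> f l = 0 \<and>
     (\<forall>j. 1 \<le> j \<and> j \<le> l \<longrightarrow> of_nat j * f j =
        s / 2 * refl_comb \<sigma> l \<chi> f (j - 1) + \<sigma> * a / 2 * refl_comb \<sigma> l \<chi> f (l - j))"

lemma kernel_row:
  fixes v :: "complex vec"
  assumes v: "v \<in> carrier_vec (Suc l)" and i: "i < Suc l"
  shows "((G1 l \<chi> a s + \<sigma> \<cdot>\<^sub>m G2 l \<chi> a s) *\<^sub>v v) $ i =
    (if i = l then 1 / 2 * v $ l + \<sigma> * \<chi> * v $ 0
     else s / 2 * v $ i + (\<chi> * a - of_nat (Suc i)) * v $ Suc i
       + \<sigma> * (a / 2 * v $ (l - Suc i) + \<chi> * s * v $ (l - i)))"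
proof -
  have G1: "G1_entry l \<chi> a s (i + 1) (k + 1) =
      (if k = i then (if i = l then 1 / 2 else s / 2) else 0)
      + (if k = Suc i then (if i = l then 0 else \<chi> * a - of_nat (Suc i)) else 0)" for k
    using i by (auto simp: G1_entry_def)
  \<comment> \<open>In the last row both \<open>l - Suc i\<close> (by truncation) and
    \<open>l - i\<close> are 0; the first term then has coefficient 0, so the corner entry is
    counted once.\<close>
  have G2: "G2_entry l \<chi> a s (i + 1) (k + 1) =
      (if k = l - Suc i then (if i = l then 0 else a / 2) else 0)
      + (if k = l - i then (if i = l then \<chi> else \<chi> * s) else 0)" for k
    using i by (auto simp: G2_entry_def)
  have if_mult: "(if P then x else 0) * y = (if P then x * y else 0)"
    "y * (if P then x else 0) = (if P then y * x else 0)" for P and x y :: complex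
    by simp_all
  have "((G1 l \<chi> a s + \<sigma> \<cdot>\<^sub>m G2 l \<chi> a s) *\<^sub>v v) $ i =
     (\<Sum>k<Suc l. (G1_entry l \<chi> a s (i + 1) (k + 1) + \<sigma> * G2_entry l \<chi> a s (i + 1) (k + 1)) * v $ k)"
    using v i by (simp add: G1_def G2_def scalar_prod_def lessThan_atLeast0)
  also have "\<dots> = (\<Sum>k<Suc l.
      (if k = i then (if i = l then 1 / 2 else s / 2) * v $ k else 0)
      + (if k = Suc i then (if i = l then 0 else \<chi> * a - of_nat (Suc i)) * v $ k else 0)
      + (if k = l - Suc i then \<sigma> * (if i = l then 0 else a / 2) * v $ k else 0)
      + (if k = l - i then \<sigma> * (if i = l then \<chi> else \<chi> * s) * v $ k else 0))"
    unfolding G1 G2 by (intro sum.cong refl) (simp only: ring_distribs if_mult mult.assoc add.assoc)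
  also have "\<dots> = (if i = l then 1 / 2 * v $ l + \<sigma> * \<chi> * v $ 0
     else s / 2 * v $ i + (\<chi> * a - of_nat (Suc i)) * v $ Suc i
       + \<sigma> * (a / 2 * v $ (l - Suc i) + \<chi> * s * v $ (l - i)))"
  proof (cases "i = l")
    case True
    then show ?thesis unfolding sum.distrib sum.delta[OF finite_lessThan] by simp
  next
    case False
    then have "i < l" using i by simp
    moreover have "l - i < Suc l" "l - Suc i < Suc l" by simp_all
    ultimately show ?thesis unfolding sum.distrib sum.delta[OF finite_lessThan] by (simp add: algebra_simps)
  qed
  finally show ?thesis .
qed

lemma mult_mat_vec_zero_iff_kernel_rel:
  assumes \<sigma>: "\<sigma>\<^sup>2 = 1" and v: "v \<in> carrier_vec (Suc l)"
  shows "(G1 l \<chi> a s + \<sigma> \<cdot>\<^sub>m G2 l \<chi> a s) *\<^sub>v v = 0\<^sub>v (Suc l) \<longleftrightarrow> kernel_rel \<sigma> l \<chi> a s (\<lambda>i. v $ i)"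
    (is "?M *\<^sub>v v = _ \<longleftrightarrow> _")
proof -
  have ss: "\<sigma> * \<sigma> = 1" using \<sigma> by (simp add: power2_eq_square)
  have "?M *\<^sub>v v = 0\<^sub>v (Suc l) \<longleftrightarrow> (\<forall>i<Suc l. (?M *\<^sub>v v) $ i = 0)"
    by (auto simp: vec_eq_iff G1_def G2_def)
  also have "\<dots> \<longleftrightarrow> (?M *\<^sub>v v) $ l = 0 \<and> (\<forall>j. 1 \<le> j \<and> j \<le> l \<longrightarrow> (?M *\<^sub>v v) $ (j - 1) = 0)"
  proof safe
    fix i assume *: "(?M *\<^sub>v v) $ l = 0" "\<forall>j. 1 \<le> j \<and> j \<le> l \<longrightarrow> (?M *\<^sub>v v) $ (j - 1) = 0" "i < Suc l"
    then show "(?M *\<^sub>v v) $ i = 0"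
      by (cases "i = l") (auto dest!: spec[of _ "Suc i"])
  qed auto
  also have "(?M *\<^sub>v v) $ l = 0 \<longleftrightarrow> refl_comb \<sigma> l \<chi> (\<lambda>i. v $ i) l = 0"
  proof -
    have "refl_comb \<sigma> l \<chi> (\<lambda>i. v $ i) l = 2 * (?M *\<^sub>v v) $ l"
      using kernel_row[OF v, of l] by (simp add: refl_comb_def algebra_simps)
    then show ?thesis by simp
  qed
  also have "(\<forall>j. 1 \<le> j \<and> j \<le> l \<longrightarrow> (?M *\<^sub>v v) $ (j - 1) = 0) \<longleftrightarrow>
    (\<forall>j. 1 \<le> j \<and> j \<le> l \<longrightarrow> of_nat j * v $ j =
        s / 2 * refl_comb \<sigma> l \<chi> (\<lambda>i. v $ i) (j - 1) + \<sigma> * a / 2 * refl_comb \<sigma> l \<chi> (\<lambda>i. v $ i) (l - j))"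
  proof (intro all_cong1 imp_cong refl)
    fix j assume j: "1 \<le> j \<and> j \<le> l"
    then have eqs: "Suc (j - 1) = j" "l - (j - 1) = Suc (l - j)" "l - (l - j) = j" "j - 1 < Suc l" "j - 1 \<noteq> l"
      by auto
    \<comment> \<open>The last summand keeps this a polynomial identity in \<sigma>; it disappears
      afterwards by \<sigma>^2 = 1.\<close>
    have "(?M *\<^sub>v v) $ (j - 1) = s / 2 * refl_comb \<sigma> l \<chi> (\<lambda>i. v $ i) (j - 1)
        + \<sigma> * a / 2 * refl_comb \<sigma> l \<chi> (\<lambda>i. v $ i) (l - j) - of_nat j * v $ j
        + (1 - \<sigma> * \<sigma>) * \<chi> * a * v $ j"
      unfolding kernel_row[OF v eqs(4)] refl_comb_def using eqs by (simp add: field_simps)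
    then show "(?M *\<^sub>v v) $ (j - 1) = 0 \<longleftrightarrow> of_nat j * v $ j =
        s / 2 * refl_comb \<sigma> l \<chi> (\<lambda>i. v $ i) (j - 1) + \<sigma> * a / 2 * refl_comb \<sigma> l \<chi> (\<lambda>i. v $ i) (l - j)"
      by (auto simp: ss)
  qed
  finally show ?thesis by (simp add: kernel_rel_def)
qed

lemma kernel_rel_cong:
  assumes "\<And>i. i \<le> l \<Longrightarrow> f i = g i"
  shows "kernel_rel \<sigma> l \<chi> a s f \<longleftrightarrow> kernel_rel \<sigma> l \<chi> a s g"
proof -
  have "refl_comb \<sigma> l \<chi> f i = refl_comb \<sigma> l \<chi> g i" if "i \<le> l" for i
    using that assms by (simp add: refl_comb_def)
  moreover have "j - 1 \<le> l" if "j \<le> l" for j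
    using that by simp
  ultimately show ?thesis
    unfolding kernel_rel_def using assms by (intro conj_cong all_cong1 imp_cong) auto
qed

lemma det_surface_iff:
  assumes \<sigma>: "\<sigma>\<^sup>2 = 1"
  shows "(\<chi>, a, s) \<in> det_surface \<sigma> l \<longleftrightarrow> (\<exists>f. (\<exists>i\<le>l. f i \<noteq> 0) \<and> kernel_rel \<sigma> l \<chi> a s f)"
proof -
  let ?M = "G1 l \<chi> a s + \<sigma> \<cdot>\<^sub>m G2 l \<chi> a s"
  have "?M \<in> carrier_mat (Suc l) (Suc l)" by (simp add: G1_def G2_def)
  then have "(\<chi>, a, s) \<in> det_surface \<sigma> l \<longleftrightarrow>
      (\<exists>v. v \<in> carrier_vec (Suc l) \<and> v \<noteq> 0\<^sub>v (Suc l) \<and> ?M *\<^sub>v v = 0\<^sub>v (Suc l))"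
    by (simp add: det_surface_def det_0_iff_vec_prod_zero)
  also have "\<dots> \<longleftrightarrow> (\<exists>v. v \<in> carrier_vec (Suc l) \<and> (\<exists>i\<le>l. v $ i \<noteq> 0) \<and> kernel_rel \<sigma> l \<chi> a s (\<lambda>i. v $ i))"
  proof -
    have "v \<noteq> 0\<^sub>v (Suc l) \<longleftrightarrow> (\<exists>i\<le>l. v $ i \<noteq> 0)" if "v \<in> carrier_vec (Suc l)" for v :: "complex vec"
      using that by (auto simp: vec_eq_iff less_Suc_eq_le)
    then show ?thesis using mult_mat_vec_zero_iff_kernel_rel[OF \<sigma>] by blast
  qed
  also have "\<dots> \<longleftrightarrow> (\<exists>f. (\<exists>i\<le>l. f i \<noteq> 0) \<and> kernel_rel \<sigma> l \<chi> a s f)"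
  proof (intro iffI; elim exE conjE)
    fix f i assume f: "f i \<noteq> 0" "i \<le> l" "kernel_rel \<sigma> l \<chi> a s f"
    have "kernel_rel \<sigma> l \<chi> a s (\<lambda>i. Matrix.vec (Suc l) f $ i)"
      using f(3) by (subst kernel_rel_cong[of l _ f]) (auto simp: less_Suc_eq_le)
    then show "\<exists>v. v \<in> carrier_vec (Suc l) \<and> (\<exists>i\<le>l. v $ i \<noteq> 0) \<and> kernel_rel \<sigma> l \<chi> a s (\<lambda>i. v $ i)"
      using f by (intro exI[of _ "Matrix.vec (Suc l) f"]) auto
  qed auto
  finally show ?thesis .
qed

text \<open>A Schlesinger transformation: the kernel vector at level \<open>m\<close> is \<open>refl_comb \<sigma> (m + 1) \<chi> f\<close>.\<close>
lemma det_surface_step: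
  assumes \<sigma>: "\<sigma>\<^sup>2 = 1" and p: "(\<chi>, a, s) \<in> det_surface \<sigma> (Suc m)" and s: "s \<noteq> 0" and \<chi>: "4 * \<chi>\<^sup>2 \<noteq> 1"
  shows "((a / 2 + 2 * \<chi> * of_nat (Suc m) / (1 - 4 * \<chi>\<^sup>2)) / s, - 2 * \<chi> * s, s) \<in> det_surface \<sigma> m"
proof -
  have ss: "\<sigma> * \<sigma> = 1" using \<sigma> by (simp add: power2_eq_square)
  define l where "l = Suc m"
  obtain f i0 where i0: "i0 \<le> l" "f i0 \<noteq> 0" and f: "kernel_rel \<sigma> l \<chi> a s f"
    using p det_surface_iff[OF \<sigma>] unfolding l_def by blast
  define h where "h = refl_comb \<sigma> l \<chi> f"
  define D where "D = 1 - 4 * \<chi>\<^sup>2"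
  define \<chi>' where "\<chi>' = (a / 2 + 2 * \<chi> * of_nat l / D) / s"
  have D: "D \<noteq> 0" using \<chi> by (simp add: D_def)
  have \<chi>': "s * \<chi>' = a / 2 + 2 * \<chi> * of_nat l / D"
    using s by (simp add: \<chi>'_def)
  have f_h: "D * f j = h j - 2 * \<chi> * \<sigma> * h (l - j)" if "j \<le> l" for j
    using refl_comb_inverse[OF \<sigma> that] by (simp add: D_def h_def)
  have row: "of_nat j * f j = s / 2 * h (j - 1) + \<sigma> * a / 2 * h (l - j)" if "1 \<le> j" "j \<le> l" for j
    using f that unfolding kernel_rel_def h_def by auto
  \<comment> \<open>The last row of the old system says that \<open>h\<close> ends at index
    \<open>m\<close>: this is the drop in degree.\<close>
  have hl: "h l = 0" using f unfolding kernel_rel_def h_def by auto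
  have "\<exists>i\<le>m. h i \<noteq> 0"
  proof (rule ccontr)
    assume "\<not> ?thesis"
    then have "h i = 0" if "i \<le> l" for i
      using that hl by (cases "i = l") (auto simp: l_def)
    then have "D * f i0 = 0" using f_h[OF i0(1)] i0 by simp
    then show False using D i0 by simp
  qed
  moreover have "kernel_rel \<sigma> m \<chi>' (- 2 * \<chi> * s) s h"
    unfolding kernel_rel_def
  proof (intro conjI allI impI)
    \<comment> \<open>Row \<open>l\<close> of the old system, with \<open>f l\<close> written in
      terms of \<open>h 0\<close>, becomes the closing equation of the new one; this is what fixes
      \<chi>'.\<close>
    have "of_nat l * (D * f l) = D * (s / 2 * h (l - 1) + \<sigma> * a / 2 * h 0)"
      using row[of l] by (simp add: l_def)
    then have "- 2 * of_nat l * \<chi> * \<sigma> * h 0 = D * (s / 2 * h (l - 1) + \<sigma> * a / 2 * h 0)"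
      using f_h[of l] by (simp add: hl mult_ac)
    moreover have "l - 1 = m" by (simp add: l_def)
    ultimately have "D * (s / 2 * h m + \<sigma> * a / 2 * h 0) = - 2 * of_nat l * \<chi> * \<sigma> * h 0"
      by simp
    then have "D * (s / 2 * h m + \<sigma> * a / 2 * h 0) + 2 * of_nat l * \<chi> * \<sigma> * h 0 = 0"
      by simp
    moreover have "D * (s / 2 * h m + \<sigma> * h 0 * (s * \<chi>')) =
        D * (s / 2 * h m + \<sigma> * a / 2 * h 0) + 2 * of_nat l * \<chi> * \<sigma> * h 0"
      unfolding \<chi>' using D by (simp add: field_simps)
    ultimately have "D * (s / 2 * h m + \<sigma> * h 0 * (s * \<chi>')) = 0" by simp
    then have "s / 2 * h m + \<sigma> * h 0 * (s * \<chi>') = 0" using D by simp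
    then have "s / 2 * (h m + 2 * \<sigma> * \<chi>' * h 0) = 0" by (simp add: algebra_simps)
    then show "refl_comb \<sigma> m \<chi>' h m = 0" using s by (simp add: refl_comb_def mult_ac)
  next
    fix j assume j: "1 \<le> j \<and> j \<le> m"
    then have jj: "m - (j - 1) = l - j" "l - j - 1 = m - j" "m - (m - j) = j" "l - (l - j) = j"
      "1 \<le> l - j" "l - j \<le> l" "1 \<le> j" "j \<le> l" by (auto simp: l_def)
    have r1: "of_nat j * f j = s / 2 * h (j - 1) + \<sigma> * a / 2 * h (l - j)"
      by (rule row) (use jj in auto)
    have r2: "of_nat (l - j) * f (l - j) = s / 2 * h (m - j) + \<sigma> * a / 2 * h j"
      using row[of "l - j"] jj by simp
    have lj: "(of_nat (l - j) :: complex) = of_nat l - of_nat j"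
      using jj by (simp add: of_nat_diff)
    have r3: "f (l - j) = (h (l - j) - 2 * \<chi> * \<sigma> * h j) / D"
      using f_h[of "l - j"] jj D by (simp add: field_simps)
    \<comment> \<open>Writing \<open>j\<close> as \<open>l - (l - j)\<close> in front of
      \<open>f (l - j)\<close> brings in rows \<open>j\<close> and \<open>l - j\<close> of the old
      system; the remaining multiple of \<open>l\<close> is expressed by \<open>h\<close>. The term
      in \<open>h (m - j)\<close> shows that the new \<open>a\<close> is
      \<open>- 2 * \<chi> * s\<close>.\<close>
    have "of_nat j * h j = of_nat j * f j + 2 * \<chi> * \<sigma> * (of_nat l * f (l - j) - of_nat (l - j) * f (l - j))"
      unfolding lj by (simp add: h_def refl_comb_def algebra_simps)
    also have "\<dots> = s / 2 * h (j - 1) + \<sigma> * a / 2 * h (l - j) + 2 * \<chi> * \<sigma> * (of_nat l *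
       ((h (l - j) - 2 * \<chi> * \<sigma> * h j) / D)
        - (s / 2 * h (m - j) + \<sigma> * a / 2 * h j))"
      unfolding r1 r2 unfolding r3 ..
    also have "\<dots> = s / 2 * h (j - 1) + \<sigma> * (s * \<chi>') * h (l - j)
        - \<sigma> * \<chi> * s * h (m - j) - (\<sigma> * \<sigma>) * 2 * \<chi> * (s * \<chi>') * h j"
      unfolding \<chi>' by (simp add: algebra_simps add_divide_distrib diff_divide_distrib)
    also have "\<dots> = s / 2 * refl_comb \<sigma> m \<chi>' h (j - 1) + \<sigma> * (- 2 * \<chi> * s) / 2 * refl_comb \<sigma> m \<chi>' h (m - j)"
      unfolding refl_comb_def jj by (simp add: algebra_simps ss)
    finally show "of_nat j * h j = s / 2 * refl_comb \<sigma> m \<chi>' h (j - 1)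
      + \<sigma> * (- 2 * \<chi> * s) / 2 * refl_comb \<sigma> m \<chi>' h (m - j)" .
  qed
  ultimately show ?thesis
    unfolding det_surface_iff[OF \<sigma>] \<chi>'_def D_def l_def by blast
qed

text \<open>The inverse transformation: \<chi> is read off from the second coordinate,
  \<open>a\<close> solves the formula for \<chi>', and \<open>f\<close> comes from inverting
  \<open>refl_comb\<close>. The system for \<open>h\<close> yields only combinations of the rows for
  \<open>f\<close>, but rows \<open>j\<close> and \<open>l - j\<close> together separate
  them.\<close>

lemma det_surface_step_back:
  assumes \<sigma>: "\<sigma>\<^sup>2 = 1" and p: "(\<chi>', - 2 * \<chi> * s, s) \<in> det_surface \<sigma> m" and s: "s \<noteq> 0" and \<chi>: "4 * \<chi>\<^sup>2 \<noteq> 1"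
  shows "(\<chi>, 2 * s * \<chi>' - 4 * \<chi> * of_nat (Suc m) / (1 - 4 * \<chi>\<^sup>2), s) \<in> det_surface \<sigma> (Suc m)"
proof -
  have ss: "\<sigma> * \<sigma> = 1" using \<sigma> by (simp add: power2_eq_square)
  define l where "l = Suc m"
  define D where "D = 1 - 4 * \<chi>\<^sup>2"
  define a where "a = 2 * s * \<chi>' - 4 * \<chi> * of_nat l / D"
  have D: "D \<noteq> 0" using \<chi> by (simp add: D_def)
  have \<chi>': "s * \<chi>' = a / 2 + 2 * \<chi> * of_nat l / D"
    using D by (simp add: a_def field_simps)
  obtain g i0 where i0: "i0 \<le> m" "g i0 \<noteq> 0" and g: "kernel_rel \<sigma> m \<chi>' (- 2 * \<chi> * s) s g"
    using p det_surface_iff[OF \<sigma>] by blast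
  \<comment> \<open>The value 0 at index \<open>l\<close> supplies the last equation at level
    \<open>l\<close>.\<close>
  define h where "h i = (if i \<le> m then g i else 0)" for i
  have h: "kernel_rel \<sigma> m \<chi>' (- 2 * \<chi> * s) s h"
    using g by (subst kernel_rel_cong[of _ _ g]) (auto simp: h_def)
  have hl: "h l = 0" by (simp add: h_def l_def)
  define f where "f j = (h j - 2 * \<chi> * \<sigma> * h (l - j)) / D" for j
  have h_f: "refl_comb \<sigma> l \<chi> f j = h j" if "j \<le> l" for j
  proof -
    have "D * refl_comb \<sigma> l \<chi> f j = (1 - 4 * \<chi>\<^sup>2 * (\<sigma> * \<sigma>)) * h j"
      using that D by (simp add: f_def refl_comb_def field_simps power2_eq_square)
    then show ?thesis using D by (simp add: ss D_def)
  qed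
  have "\<exists>i\<le>l. f i \<noteq> 0"
  proof (rule ccontr)
    assume "\<not> ?thesis"
    then have "refl_comb \<sigma> l \<chi> f i0 = 0" using i0 by (simp add: refl_comb_def l_def)
    then show False using h_f[of i0] i0 by (simp add: h_def l_def)
  qed
  moreover have "kernel_rel \<sigma> l \<chi> a s f"
    unfolding kernel_rel_def
  proof (intro conjI allI impI)
    show "refl_comb \<sigma> l \<chi> f l = 0" using h_f[of l] hl by simp
    \<comment> \<open>The defect of row \<open>j\<close>. For 1 \<le> j \<le> m it equals 2 \<chi>
      \<sigma> times the defect of row \<open>l - j\<close>; using this twice multiplies it by 4
      \<chi>^2, so it is 0. Row \<open>l\<close> has no such partner and follows from the closing
      equation.\<close>
    define e where "e j = of_nat j * f j - (s / 2 * h (j - 1) + \<sigma> * a / 2 * h (l - j))" for j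
    have e: "e j - 2 * \<chi> * \<sigma> * e (l - j) = 0" if j: "1 \<le> j" "j \<le> m" for j
    proof -
      have jj: "m - (j - 1) = l - j" "l - j - 1 = m - j" "m - (m - j) = j" "l - (l - j) = j"
        "1 \<le> l - j" "l - j \<le> l" "1 \<le> j" "j \<le> l" using j by (auto simp: l_def)
      have lj: "(of_nat (l - j) :: complex) = of_nat l - of_nat j"
        using jj by (simp add: of_nat_diff)
      have "of_nat j * h j = s / 2 * refl_comb \<sigma> m \<chi>' h (j - 1)
          + \<sigma> * (- 2 * \<chi> * s) / 2 * refl_comb \<sigma> m \<chi>' h (m - j)"
        using h j by (simp add: kernel_rel_def)
      also have "\<dots> = s / 2 * h (j - 1) + \<sigma> * (s * \<chi>') * h (l - j)
          - \<sigma> * \<chi> * s * h (m - j) - (\<sigma> * \<sigma>) * 2 * \<chi> * (s * \<chi>') * h j"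
        unfolding refl_comb_def jj by (simp add: algebra_simps ss)
      also have "\<dots> = s / 2 * h (j - 1) + \<sigma> * a / 2 * h (l - j) + 2 * \<chi> * \<sigma> * (of_nat l *
          ((h (l - j) - 2 * \<chi> * \<sigma> * h j) / D)
          - (s / 2 * h (m - j) + \<sigma> * a / 2 * h j))"
        unfolding \<chi>' by (simp add: algebra_simps add_divide_distrib diff_divide_distrib)
      also have "(h (l - j) - 2 * \<chi> * \<sigma> * h j) / D = f (l - j)"
        using jj by (simp add: f_def)
      finally have 1: "of_nat j * h j = s / 2 * h (j - 1) + \<sigma> * a / 2 * h (l - j) + 2 * \<chi> * \<sigma> * (of_nat l *
          f (l - j) - (s / 2 * h (m - j) + \<sigma> * a / 2 * h j))" .
      have 2: "h j = f j + 2 * \<chi> * \<sigma> * f (l - j)"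
        using h_f[of j] jj by (simp add: refl_comb_def)
      have "e j - 2 * \<chi> * \<sigma> * e (l - j) = of_nat j * (f j + 2 * \<chi> * \<sigma> * f (l - j)) - (s / 2 * h (j - 1) + \<sigma> * a / 2 * h (l - j) + 2 * \<chi> * \<sigma> * (of_nat l *
          f (l - j) - (s / 2 * h (m - j) + \<sigma> * a / 2 * h j)))"
        unfolding e_def lj jj by (simp add: algebra_simps)
      then show ?thesis using 1 2 by simp
    qed
    fix j assume j: "1 \<le> j \<and> j \<le> l"
    have "e j = 0"
    proof (cases "j = l")
      case True
      have "h m + 2 * \<chi>' * \<sigma> * h 0 = 0"
        using h by (simp add: kernel_rel_def refl_comb_def)
      then have "s * (h m + 2 * \<chi>' * \<sigma> * h 0) = 0" by simp
      then have "s * h m + 2 * (s * \<chi>') * \<sigma> * h 0 = 0" by (simp add: algebra_simps)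
      then have "D * (s * h m + 2 * (a / 2 + 2 * \<chi> * of_nat l / D) * \<sigma> * h 0) = 0"
        unfolding \<chi>' by simp
      also have "D * (s * h m + 2 * (a / 2 + 2 * \<chi> * of_nat l / D) * \<sigma> * h 0) =
          D * s * h m + D * a * \<sigma> * h 0 + 4 * \<chi> * of_nat l * \<sigma> * h 0"
        using D by (simp add: field_simps)
      also have "\<dots> = - (2 * of_nat l * (- 2 * \<chi> * \<sigma> * h 0) - (D * s * h m + D * a * \<sigma> * h 0))"
        by (simp add: algebra_simps)
      also have "- 2 * \<chi> * \<sigma> * h 0 = D * f l"
        using D by (simp add: f_def hl)
      also have "- (2 * of_nat l * (D * f l) - (D * s * h m + D * a * \<sigma> * h 0)) = - 2 * (D * e l)"
        by (simp add: e_def l_def algebra_simps)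
      finally have "D * e l = 0" by simp
      then show ?thesis using D True by simp
    next
      case False
      then have "j \<le> m" "1 \<le> l - j" "l - j \<le> m" "l - (l - j) = j" using j by (auto simp: l_def)
      then have ee: "e j - 2 * \<chi> * \<sigma> * e (l - j) = 0" "e (l - j) - 2 * \<chi> * \<sigma> * e j = 0"
        using e[of j] e[of "l - j"] j by auto
      have "(1 - 4 * \<chi>\<^sup>2 * (\<sigma> * \<sigma>)) * e j =
          (e j - 2 * \<chi> * \<sigma> * e (l - j)) + 2 * \<chi> * \<sigma> * (e (l - j) - 2 * \<chi> * \<sigma> * e j)"
        by (simp add: algebra_simps power2_eq_square)
      also have "\<dots> = 0" unfolding ee by simp
      finally have "(1 - 4 * \<chi>\<^sup>2 * (\<sigma> * \<sigma>)) * e j = 0" .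
      then show ?thesis using D by (simp add: ss D_def)
    qed
    moreover have "j - 1 \<le> l" "l - j \<le> l" using j by auto
    ultimately show "of_nat j * f j = s / 2 * refl_comb \<sigma> l \<chi> f (j - 1) + \<sigma> * a / 2 * refl_comb \<sigma> l \<chi> f (l - j)"
      using h_f[of "j - 1"] h_f[of "l - j"] by (simp add: e_def)
  qed
  ultimately show ?thesis
    unfolding det_surface_iff[OF \<sigma>] a_def D_def l_def by blast
qed

section \<open>Density of the generic points\<close>

lemma kernel_rel_zero_of_large:
  assumes \<sigma>: "\<sigma>\<^sup>2 = 1" and \<chi>: "4 * \<chi>\<^sup>2 \<noteq> 1" and f: "kernel_rel \<sigma> l \<chi> a s f"
    and a: "norm a > norm s + 2 * (of_nat l * ((1 + 2 * norm \<chi>) / norm (1 - 4 * \<chi>\<^sup>2)))"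
    and i: "i \<le> l"
  shows "f i = 0"
proof -
  define h where "h = refl_comb \<sigma> l \<chi> f"
  define D where "D = 1 - 4 * \<chi>\<^sup>2"
  have D: "D \<noteq> 0" using \<chi> by (simp add: D_def)
  have n\<sigma>: "norm \<sigma> = 1"
    using abs_square_eq_1[of "norm \<sigma>"] \<sigma> by (simp flip: norm_power)
  define M where "M = Max ((\<lambda>i. norm (h i)) ` {..l})"
  have hM: "norm (h i) \<le> M" if "i \<le> l" for i
    unfolding M_def using that by (intro Max_ge) auto
  have "M \<in> (\<lambda>i. norm (h i)) ` {..l}" unfolding M_def by (intro Max_in) auto
  then obtain i0 where i0: "i0 \<le> l" "M = norm (h i0)" by auto
  have M0: "M \<ge> 0" using i0 by simp
  \<comment> \<open>Inverting \<open>refl_comb\<close> bounds \<open>f\<close> by the maximum of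
    \<open>h\<close>, so a large \<open>a\<close> makes the term with coefficient \<open>a\<close>
    dominate every row.\<close>
  have fM: "norm (f j) \<le> (1 + 2 * norm \<chi>) / norm D * M" if "j \<le> l" for j
  proof -
    have "norm D * norm (f j) = norm (h j - 2 * \<chi> * \<sigma> * h (l - j))"
      using refl_comb_inverse[OF \<sigma> that, of \<chi> f] by (simp add: D_def h_def flip: norm_mult)
    also have "\<dots> \<le> norm (h j) + 2 * norm \<chi> * norm (h (l - j))"
      by (rule order_trans[OF norm_triangle_ineq4]) (simp add: norm_mult n\<sigma>)
    also have "\<dots> \<le> M + 2 * norm \<chi> * M"
      using hM that by (intro add_mono mult_left_mono) auto
    finally show ?thesis using D by (simp add: field_simps)
  qed
  have "M = 0"
  proof (rule ccontr)
    assume "M \<noteq> 0"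
    then have M: "M > 0" using M0 by simp
    have hl: "h l = 0" using f by (simp add: kernel_rel_def h_def)
    then have "i0 \<noteq> l" using M i0 by auto
    \<comment> \<open>The row in which the largest entry of \<open>h\<close> is multiplied by
      \<open>a\<close>; it exists because \<open>h l = 0\<close> excludes
      \<open>i0 = l\<close>.\<close>
    define j where "j = l - i0"
    have j: "1 \<le> j" "j \<le> l" "l - j = i0" using i0 \<open>i0 \<noteq> l\<close> by (auto simp: j_def)
    have "of_nat j * f j = s / 2 * h (j - 1) + \<sigma> * a / 2 * h i0"
      using f j by (simp add: kernel_rel_def h_def)
    then have "\<sigma> * a / 2 * h i0 = of_nat j * f j - s / 2 * h (j - 1)" by simp
    then have "norm (\<sigma> * a / 2 * h i0) \<le> norm (of_nat j * f j) + norm (s / 2 * h (j - 1))"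
      using norm_triangle_ineq4 by metis
    then have "norm a / 2 * M \<le> of_nat j * norm (f j) + norm s / 2 * norm (h (j - 1))"
      by (simp add: norm_mult norm_divide n\<sigma> i0)
    also have "\<dots> \<le> of_nat l * ((1 + 2 * norm \<chi>) / norm D * M) + norm s / 2 * M"
      using j fM[of j] hM[of "j - 1"] by (intro add_mono mult_mono) auto
    finally have "norm a * M \<le> (norm s + 2 * (of_nat l * ((1 + 2 * norm \<chi>) / norm D))) * M"
      by (simp add: algebra_simps)
    then show False using a M by (simp add: D_def)
  qed
  then have "norm (f i) \<le> 0" using fM[OF i] by simp
  then show ?thesis by simp
qed

text \<open>For \<open>4 * \<chi>\<^sup>2 = 1\<close> the vector \<open>h = refl_comb \<sigma> l \<chi> f\<close> is itself (anti)symmetric, and eliminating \<open>f\<close>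
  leaves a tridiagonal system for \<open>h\<close>, which is diagonally dominant for this value of \<open>a\<close>.\<close>
lemma kernel_rel_zero_of_dominant:
  assumes \<sigma>: "\<sigma>\<^sup>2 = 1" and \<chi>: "4 * \<chi>\<^sup>2 = 1" and l: "1 \<le> l"
    and f: "kernel_rel \<sigma> l \<chi> (- 2 * \<chi> * of_real (norm s)) s f" and i: "i \<le> l"
  shows "f i = 0"
proof -
  define h where "h = refl_comb \<sigma> l \<chi> f"
  define \<epsilon> where "\<epsilon> = 2 * \<chi>"
  define r where "r = complex_of_real (norm s)"
  have \<epsilon>: "\<epsilon> * \<epsilon> = 1" using \<chi> by (simp add: \<epsilon>_def power2_eq_square)
  have ss: "\<sigma> * \<sigma> = 1" using \<sigma> by (simp add: power2_eq_square)
  have h_f: "h j = f j + \<epsilon> * \<sigma> * f (l - j)" for j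
    by (simp add: h_def refl_comb_def \<epsilon>_def)
  have sym: "h (l - j) = \<epsilon> * \<sigma> * h j" if "j \<le> l" for j
  proof -
    have "\<epsilon> * \<sigma> * h j = \<epsilon> * \<sigma> * f j + (\<epsilon> * \<epsilon>) * (\<sigma> * \<sigma>) * f (l - j)"
      unfolding h_f by (simp only: ring_distribs mult_ac)
    then show ?thesis using that by (simp add: h_f \<epsilon> ss)
  qed
  have hl: "h l = 0" using f by (simp add: kernel_rel_def h_def)
  have h0: "h 0 = 0" using sym[of l] hl by simp
  \<comment> \<open>The choice \<open>a = - \<epsilon> * r\<close> turns the reflected entry into
    \<open>- r / 2 * h j\<close>, with a sign independent of \<sigma> and \<epsilon>.\<close>
  have row: "of_nat j * f j = s / 2 * h (j - 1) - r / 2 * h j" if j: "1 \<le> j" "j \<le> l" for j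
  proof -
    have "of_nat j * f j = s / 2 * h (j - 1) + \<sigma> * (- \<epsilon> * r) / 2 * h (l - j)"
      using f j by (simp add: kernel_rel_def h_def \<epsilon>_def r_def)
    also have "\<sigma> * (- \<epsilon> * r) / 2 * h (l - j) = - (\<epsilon> * \<epsilon>) * (\<sigma> * \<sigma>) * r / 2 * h j"
      unfolding sym[OF j(2)] by simp
    finally show ?thesis by (simp add: \<epsilon> ss)
  qed
  define M where "M = Max ((\<lambda>i. norm (h i)) ` {..l})"
  have hM: "norm (h i) \<le> M" if "i \<le> l" for i
    unfolding M_def using that by (intro Max_ge) auto
  have "M \<in> (\<lambda>i. norm (h i)) ` {..l}" unfolding M_def by (intro Max_in) auto
  then obtain j where j: "j \<le> l" "M = norm (h j)" by auto
  have M: "M = 0"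
  proof (cases "j = 0 \<or> j = l")
    case True
    then show ?thesis using h0 hl j by auto
  next
    case False
    define p q where "p = 1 / real j" and "q = 1 / real (l - j)"
    have jl: "1 \<le> j" "j \<le> l" "1 \<le> l - j" "l - j \<le> l" "l - (l - j) = j" "l - j - 1 = l - (j + 1)" "j + 1 \<le> l"
      using False j by auto
    have pq: "p > 0" "q > 0" using jl by (auto simp: p_def q_def)
    have cp: "of_real p * of_nat j = (1 :: complex)" "of_real q * of_nat (l - j) = (1 :: complex)"
      using jl by (auto simp: p_def q_def)
    have "f j = of_real p * (of_nat j * f j)" using cp by (simp flip: mult.assoc)
    then have 1: "f j = of_real p * (s / 2 * h (j - 1) - r / 2 * h j)" using row jl by simp
    have "f (l - j) = of_real q * (of_nat (l - j) * f (l - j))" using cp by (simp flip: mult.assoc)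
    also have "of_nat (l - j) * f (l - j) = \<epsilon> * \<sigma> * (s / 2 * h (j + 1) - r / 2 * h j)"
      using row[of "l - j"] jl sym[of j] sym[of "j + 1"] by (simp add: algebra_simps)
    finally have "\<epsilon> * \<sigma> * f (l - j) = (\<epsilon> * \<epsilon>) * (\<sigma> * \<sigma>) * (of_real q * (s / 2 * h (j + 1) - r / 2 * h j))"
      by (simp only: mult_ac)
    then have 2: "\<epsilon> * \<sigma> * f (l - j) = of_real q * (s / 2 * h (j + 1) - r / 2 * h j)"
      by (simp add: \<epsilon> ss)
    have "h j = of_real p * (s / 2 * h (j - 1) - r / 2 * h j) + of_real q * (s / 2 * h (j + 1) - r / 2 * h j)"
      by (rule trans[OF h_f arg_cong2[where f = "(+)", OF 1 2]])
    \<comment> \<open>The diagonal coefficient exceeds the sum of the norms of the off-diagonal ones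
      by exactly 1, so an entry of maximal norm must be 0.\<close>
    then have eq: "of_real (1 + norm s / 2 * (p + q)) * h j = s / 2 * (of_real p * h (j - 1) + of_real q * h (j + 1))"
      unfolding r_def by (simp add: field_simps)
    have pos: "1 + norm s / 2 * (p + q) \<ge> 0" using pq by simp
    have "(1 + norm s / 2 * (p + q)) * M = norm (of_real (1 + norm s / 2 * (p + q)) * h j)"
      unfolding norm_mult norm_of_real using pos j by simp
    also have "\<dots> = norm s / 2 * norm (of_real p * h (j - 1) + of_real q * h (j + 1))"
      unfolding eq by (simp add: norm_mult norm_divide)
    also have "\<dots> \<le> norm s / 2 * (p * norm (h (j - 1)) + q * norm (h (j + 1)))"
      using pq by (intro mult_left_mono order_trans[OF norm_triangle_ineq]) (auto simp: norm_mult)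
    also have "\<dots> \<le> norm s / 2 * (p * M + q * M)"
      using pq hM[of "j - 1"] hM[of "j + 1"] jl by (intro mult_left_mono add_mono) auto
    finally have "M \<le> 0" by (simp add: algebra_simps add_divide_distrib)
    then show ?thesis using j by simp
  qed
  have h: "h k = 0" if "k \<le> l" for k using hM[OF that] M by simp
  \<comment> \<open>Here \<open>refl_comb\<close> need not be invertible; \<open>f\<close> is
    recovered from the rows instead, and \<open>f 0\<close> from \<open>h 0\<close> and
    \<open>f l\<close>.\<close>
  have f_pos: "f k = 0" if "1 \<le> k" "k \<le> l" for k
    using row[OF that] h[of k] h[of "k - 1"] that by simp
  have "f 0 = 0" using h_f[of 0] h[of 0] f_pos[of l] l by simp
  then show ?thesis using f_pos[of i] i by (cases "i = 0") auto
qed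

text \<open>Hence no component of the surface is a cylinder over a curve in the (\<chi>, s)-plane.
  At level 0 the determinant does not involve \<open>a\<close>, and the surface is such a
  cylinder.\<close>

lemma ex_not_in_det_surface:
  assumes \<sigma>: "\<sigma>\<^sup>2 = 1" and l: "1 \<le> l"
  shows "\<exists>a. (\<chi>, a, s) \<notin> det_surface \<sigma> l"
proof (cases "4 * \<chi>\<^sup>2 = 1")
  case True
  then show ?thesis
    using kernel_rel_zero_of_dominant[OF \<sigma> True l] det_surface_iff[OF \<sigma>] by blast
next
  case False
  define B where "B = norm s + 2 * (of_nat l * ((1 + 2 * norm \<chi>) / norm (1 - 4 * \<chi>\<^sup>2))) + 1"
  have "B \<ge> 0" by (simp add: B_def)
  then have "norm (complex_of_real B) = B" by simp
  then have "(\<chi>, of_real B, s) \<notin> det_surface \<sigma> l"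
    using kernel_rel_zero_of_large[OF \<sigma> False, of l "of_real B" s] det_surface_iff[OF \<sigma>]
    unfolding B_def by fastforce
  then show ?thesis by blast
qed

section \<open>Zeros survive small changes of the parameter\<close>

lemma zero_persists:
  fixes f :: "'p::heine_borel \<Rightarrow> complex \<Rightarrow> complex"
  assumes cont: "continuous_on UNIV (\<lambda>(p, z). f p z)" and hol: "\<And>p. f p holomorphic_on UNIV"
    and z0: "f p0 z0 = 0" and z1: "f p0 z1 \<noteq> 0" and e: "e > 0"
  shows "\<exists>d>0. \<forall>p. dist p p0 < d \<longrightarrow> (\<exists>z. dist z z0 < e \<and> f p z = 0)"
proof (rule ccontr)
  assume "\<not> ?thesis"
  then have "\<exists>p. dist p p0 < inverse (real (Suc n)) \<and> (\<forall>z. dist z z0 < e \<longrightarrow> f p z \<noteq> 0)" for n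
    by (meson inverse_positive_iff_positive of_nat_0_less_iff zero_less_Suc)
  then obtain X where X: "\<And>n. dist (X n) p0 < inverse (real (Suc n))"
    "\<And>n z. dist z z0 < e \<Longrightarrow> f (X n) z \<noteq> 0" by metis
  have lim: "X \<longlonglongrightarrow> p0"
    by (rule LIMSEQ_iff_nz[THEN iffD2] metric_tendsto_imp_tendsto[OF LIMSEQ_inverse_real_of_nat])
       (use X(1) in \<open>auto intro!: always_eventually less_imp_le\<close>)
  \<comment> \<open>By the identity theorem, constancy near the zero \<open>z0\<close> would force
    \<open>f p0 z1 = 0\<close>.\<close>
  have nonconst: "\<not> f p0 constant_on ball z0 e"
  proof
    assume "f p0 constant_on ball z0 e"
    then have "f p0 z = 0" if "z \<in> ball z0 e" for z
      using z0 that e unfolding constant_on_def by (metis centre_in_ball)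
    then have "f p0 z1 = 0"
      using analytic_continuation[OF hol[of p0] open_UNIV connected_UNIV, of "ball z0 e" z0 z1] e
      by (simp add: islimpt_ball)
    then show False using z1 by simp
  qed
  have "f p0 z0 \<noteq> 0"
  proof (rule Hurwitz_no_zeros[of "ball z0 e" "\<lambda>n. f (X n)" "f p0"])
    show "f (X n) holomorphic_on ball z0 e" "f p0 holomorphic_on ball z0 e" for n
      using hol holomorphic_on_subset by blast+
    show "f (X n) z \<noteq> 0" if "z \<in> ball z0 e" for n z
      using X(2) that by (simp add: dist_commute)
    fix K assume K: "compact K" "K \<subseteq> ball z0 e"
    \<comment> \<open>A convergent sequence with its limit is compact, so joint continuity becomes
      uniform and gives the locally uniform convergence needed for Hurwitz's theorem.\<close>
    have "compact (insert p0 (range X) \<times> K)"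
      using compact_sequence_with_limit[OF lim] K by (intro compact_Times) auto
    then have unif: "uniformly_continuous_on (insert p0 (range X) \<times> K) (\<lambda>(p, z). f p z)"
      using compact_uniformly_continuous continuous_on_subset[OF cont] by blast
    show "uniform_limit K (\<lambda>n. f (X n)) (f p0) sequentially"
    proof (rule uniform_limitI)
      fix r :: real assume "r > 0"
      then obtain d where d: "d > 0" "\<And>x y. x \<in> insert p0 (range X) \<times> K \<Longrightarrow>
          y \<in> insert p0 (range X) \<times> K \<Longrightarrow> dist y x < d \<Longrightarrow>
          dist (case y of (p, z) \<Rightarrow> f p z) (case x of (p, z) \<Rightarrow> f p z) < r"
        using unif unfolding uniformly_continuous_on_def by meson
      have "\<forall>\<^sub>F n in sequentially. dist (X n) p0 < d"
        using lim d(1) by (rule tendstoD)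
      then show "\<forall>\<^sub>F n in sequentially. \<forall>z\<in>K. dist (f (X n) z) (f p0 z) < r"
      proof eventually_elim
        case (elim n)
        then show ?case
          using d(2)[of "(p0, z)" "(X n, z)" for z] by (auto simp: dist_Pair_Pair)
      qed
    qed
  qed (use nonconst e in auto)
  then show False using z0 by simp
qed

lemma det_expansion:
  "Determinant.det (G1 l \<chi> a s + \<sigma> \<cdot>\<^sub>m G2 l \<chi> a s) =
    (\<Sum>p | p permutes {0..<Suc l}. signof p * (\<Prod>i = 0..<Suc l.
       G1_entry l \<chi> a s (Suc i) (Suc (p i)) + \<sigma> * G2_entry l \<chi> a s (Suc i) (Suc (p i))))"
proof -
  have "p i < Suc l" if "p permutes {0..<Suc l}" "i < Suc l" for p i
    using permutes_in_image[OF that(1), of i] that by auto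
  then show ?thesis
    by (subst det_def'[of _ "Suc l"]) (auto simp: G1_def G2_def intro!: sum.cong prod.cong)
qed

lemma continuous_det_surface:
  "continuous_on UNIV (\<lambda>((\<chi>, s), a). Determinant.det (G1 l \<chi> a s + \<sigma> \<cdot>\<^sub>m G2 l \<chi> a s))"
proof -
  have if_continuous: "continuous_on UNIV (\<lambda>x. if P then f x else g x)"
    if "continuous_on UNIV f" "continuous_on UNIV g" for P and f g :: "(complex \<times> complex) \<times> complex \<Rightarrow> complex"
    using that by (cases P) simp_all
  have 1: "continuous_on UNIV (\<lambda>x. G1_entry l (fst (fst x)) (snd x) (snd (fst x)) i j)" for i j
    unfolding G1_entry_def
    by (intro if_continuous continuous_intros) simp_all
  have 2: "continuous_on UNIV (\<lambda>x. G2_entry l (fst (fst x)) (snd x) (snd (fst x)) i j)" for i j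
    unfolding G2_entry_def
    by (intro if_continuous continuous_intros) simp_all
  show ?thesis
    unfolding det_expansion case_prod_unfold by (intro continuous_intros 1 2)
qed

lemma holomorphic_det_surface:
  "(\<lambda>a. Determinant.det (G1 l \<chi> a s + \<sigma> \<cdot>\<^sub>m G2 l \<chi> a s)) holomorphic_on UNIV"
proof -
  have if_holomorphic: "(\<lambda>x. if P then f x else g x) holomorphic_on UNIV"
    if "f holomorphic_on UNIV" "g holomorphic_on UNIV" for P and f g :: "complex \<Rightarrow> complex"
    using that by (cases P) simp_all
  have 1: "(\<lambda>a. G1_entry l \<chi> a s i j) holomorphic_on UNIV" for i j
    unfolding G1_entry_def
    by (intro if_holomorphic holomorphic_intros) simp_all
  have 2: "(\<lambda>a. G2_entry l \<chi> a s i j) holomorphic_on UNIV" for i j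
    unfolding G2_entry_def
    by (intro if_holomorphic holomorphic_intros) simp_all
  show ?thesis
    unfolding det_expansion by (intro holomorphic_intros 1 2)
qed

lemma ball_avoid_finite:
  assumes "finite F" "d > 0"
  shows "\<exists>t::complex. norm t < d \<and> t \<notin> F"
proof -
  have "\<not> ball 0 d \<subseteq> F"
    using assms uncountable_ball[of d "0 :: complex"] countable_finite countable_subset by blast
  then show ?thesis by auto
qed

text \<open>Shift \<chi> and \<open>s\<close> by a common small \<open>t\<close> away from the
  excluded values; a zero in \<open>a\<close> persists close to the old one.\<close>

lemma det_surface_generic_dense:
  assumes \<sigma>: "\<sigma>\<^sup>2 = 1" and l: "1 \<le> l"
  shows "det_surface \<sigma> l \<subseteq> closure {(\<chi>, a, s). (\<chi>, a, s) \<in> det_surface \<sigma> l \<and> s \<noteq> 0 \<and> 4 * \<chi>\<^sup>2 \<noteq> 1}"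
    (is "_ \<subseteq> closure ?G")
proof (clarify, unfold closure_approachable, intro allI impI)
  fix \<chi> a s :: complex and e :: real
  assume p: "(\<chi>, a, s) \<in> det_surface \<sigma> l" and e: "e > 0"
  define f where "f = (\<lambda>(\<chi>, s) a. Determinant.det (G1 l \<chi> a s + \<sigma> \<cdot>\<^sub>m G2 l \<chi> a s))"
  have mem: "(\<chi>, a, s) \<in> det_surface \<sigma> l \<longleftrightarrow> f (\<chi>, s) a = 0" for \<chi> a s
    by (simp add: f_def det_surface_def)
  obtain a1 where "f (\<chi>, s) a1 \<noteq> 0"
    using ex_not_in_det_surface[OF \<sigma> l] mem by blast
  moreover have "continuous_on UNIV (\<lambda>(p, a). f p a)"
    using continuous_det_surface[of l \<sigma>] by (simp add: f_def case_prod_unfold)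
  moreover have "f p holomorphic_on UNIV" for p
    using holomorphic_det_surface by (simp add: f_def case_prod_unfold)
  ultimately obtain d where d: "d > 0"
    "\<And>p. dist p (\<chi>, s) < d \<Longrightarrow> \<exists>z. dist z a < e / 3 \<and> f p z = 0"
    using zero_persists[of f "(\<chi>, s)" a a1 "e / 3"] p mem e by auto
  \<comment> \<open>The shift acts on two coordinates, hence \<open>d / 2\<close>; the two shifts
    and the change of \<open>a\<close> each get a third of \<open>e\<close>. The three values to
    avoid are the solutions of s + t = 0 and 2 (\<chi> + t) = 1 or -1.\<close>
  define r where "r = min (d / 2) (e / 3)"
  have "finite {- s, 1 / 2 - \<chi>, - 1 / 2 - \<chi>}" "r > 0" using d e by (auto simp: r_def)
  from ball_avoid_finite[OF this] obtain t
    where t: "norm t < r" "t \<noteq> - s" "t \<noteq> 1 / 2 - \<chi>" "t \<noteq> - 1 / 2 - \<chi>" by blast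
  have dist_le: "dist (x, y) (x', y') \<le> dist x x' + dist y y'"
    for x x' :: complex and y y' :: "'b::metric_space"
    unfolding dist_Pair_Pair by (rule sqrt_sum_squares_le_sum) auto
  have "dist (\<chi> + t, s + t) (\<chi>, s) < d"
    using dist_le[of "\<chi> + t" "s + t" \<chi> s] t(1) by (simp add: dist_norm r_def)
  then obtain z where z: "dist z a < e / 3" "f (\<chi> + t, s + t) z = 0" using d by blast
  have "s + t \<noteq> 0" using t by (auto simp: add_eq_0_iff)
  moreover have "4 * (\<chi> + t)\<^sup>2 \<noteq> 1"
  proof
    assume "4 * (\<chi> + t)\<^sup>2 = 1"
    then have "(2 * (\<chi> + t))\<^sup>2 = 1" by (simp only: power_mult_distrib) simp
    then have "2 * (\<chi> + t) = 1 \<or> 2 * (\<chi> + t) = -1" by (simp only: power2_eq_1_iff)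
    then have "t = 1 / 2 - \<chi> \<or> t = - 1 / 2 - \<chi>" by (auto simp: field_simps)
    then show False using t by blast
  qed
  moreover have "dist (\<chi> + t, z, s + t) (\<chi>, a, s) < e"
    using dist_le[of "\<chi> + t" "(z, s + t)" \<chi> "(a, s)"] dist_le[of z "s + t" a s] t(1) z(1)
    by (simp add: dist_norm r_def)
  ultimately show "\<exists>y\<in>?G. dist y (\<chi>, a, s) < e"
    using z(2) mem by (intro bexI[of _ "(\<chi> + t, z, s + t)"]) auto
qed

section \<open>The parametrization by discrete Painleve II\<close>

text \<open>
  The discrete Painleve II equation: the value at level \<open>k\<close> is \<open>2 \<chi>\<^sub>k\<close> along the chain of the transformations
  \<open>det_surface_step_back\<close>, which give \<open>a\<^sub>k = - 2 s \<chi>\<^sub>k\<^sub>+\<^sub>1\<close>, started from the plane \<open>\<chi>\<^sub>0 = - \<sigma> / 2\<close>.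
\<close>
fun dp2 :: "complex \<Rightarrow> complex \<times> complex \<Rightarrow> nat \<Rightarrow> complex" where
  "dp2 \<sigma> p 0 = - \<sigma>"
| "dp2 \<sigma> p (Suc 0) = fst p"
| "dp2 \<sigma> p (Suc (Suc k)) =
    2 * of_nat (Suc k) * dp2 \<sigma> p (Suc k) / (snd p * (1 - (dp2 \<sigma> p (Suc k))\<^sup>2)) - dp2 \<sigma> p k"

text \<open>Exactly the divisions in \<open>dp2\<close> up to index \<open>Suc l\<close> are made
  safe, besides \<open>s \<noteq> 0\<close>. Index 0 is left out because
  \<open>dp2 \<sigma> p 0\<close> has square 1 when \<sigma>^2 = 1.\<close>

definition param_dom :: "complex \<Rightarrow> nat \<Rightarrow> (complex \<times> complex) set" where
  "param_dom \<sigma> l = {p. snd p \<noteq> 0 \<and> (\<forall>k. 1 \<le> k \<and> k \<le> l \<longrightarrow> (dp2 \<sigma> p k)\<^sup>2 \<noteq> 1)}"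

definition param :: "complex \<Rightarrow> nat \<Rightarrow> complex \<times> complex \<Rightarrow> complex \<times> complex \<times> complex" where
  "param \<sigma> l p = (dp2 \<sigma> p l / 2, - snd p * dp2 \<sigma> p (Suc l), snd p)"

lemma param_dom_Suc: "p \<in> param_dom \<sigma> (Suc m) \<longleftrightarrow> p \<in> param_dom \<sigma> m \<and> (dp2 \<sigma> p (Suc m))\<^sup>2 \<noteq> 1"
  by (auto simp: param_dom_def le_Suc_eq)

lemma det_surface_0:
  assumes \<sigma>: "\<sigma>\<^sup>2 = 1"
  shows "(\<chi>, a, s) \<in> det_surface \<sigma> 0 \<longleftrightarrow> \<chi> = - \<sigma> / 2"
proof -
  have ss: "\<sigma> * \<sigma> = 1" using \<sigma> by (simp add: power2_eq_square)
  have "(\<chi>, a, s) \<in> det_surface \<sigma> 0 \<longleftrightarrow> (\<exists>f :: nat \<Rightarrow> complex. f 0 \<noteq> 0 \<and> (1 + 2 * \<chi> * \<sigma>) * f 0 = 0)"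
    by (simp add: det_surface_iff[OF \<sigma>] kernel_rel_def refl_comb_def algebra_simps)
  also have "\<dots> \<longleftrightarrow> 1 + 2 * \<chi> * \<sigma> = 0"
    by (auto intro: exI[of _ "\<lambda>_. 1"])
  also have "\<dots> \<longleftrightarrow> \<chi> = - \<sigma> / 2"
  proof
    assume "1 + 2 * \<chi> * \<sigma> = 0"
    then have "\<sigma> * (1 + 2 * \<chi> * \<sigma>) = 0" by simp
    also have "\<sigma> * (1 + 2 * \<chi> * \<sigma>) = \<sigma> + 2 * \<chi> * (\<sigma> * \<sigma>)" by (simp add: algebra_simps)
    finally have "2 * \<chi> = - \<sigma>" by (simp add: ss add_eq_0_iff)
    then show "\<chi> = - \<sigma> / 2" by (metis nonzero_mult_div_cancel_left zero_neq_numeral)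
  qed (simp add: ss)
  finally show ?thesis .
qed

text \<open>With \<chi>' and \<chi> half of two consecutive values of \<open>dp2\<close>, the
  formula for \<open>a\<close> in \<open>det_surface_step_back\<close> is the recurrence multiplied
  by \<open>- s\<close>.\<close>

lemma param_in_det_surface:
  assumes \<sigma>: "\<sigma>\<^sup>2 = 1"
  shows "p \<in> param_dom \<sigma> l \<Longrightarrow> param \<sigma> l p \<in> det_surface \<sigma> l"
proof (induction l)
  case 0
  then show ?case by (simp add: param_def det_surface_0[OF \<sigma>])
next
  case (Suc m)
  define w where "w = dp2 \<sigma> p (Suc m)"
  have s: "snd p \<noteq> 0" and w: "w\<^sup>2 \<noteq> 1" "1 - w\<^sup>2 \<noteq> 0"
    using Suc.prems by (auto simp: param_dom_def w_def)
  have "4 * (w / 2)\<^sup>2 = w\<^sup>2" by (simp add: power_divide)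
  moreover have "(dp2 \<sigma> p m / 2, - 2 * (w / 2) * snd p, snd p) \<in> det_surface \<sigma> m"
    using Suc by (simp add: param_dom_Suc param_def w_def mult.commute)
  ultimately have "(w / 2, 2 * snd p * (dp2 \<sigma> p m / 2) - 4 * (w / 2) * of_nat (Suc m) / (1 - w\<^sup>2), snd p)
      \<in> det_surface \<sigma> (Suc m)"
    using det_surface_step_back[OF \<sigma>, of "dp2 \<sigma> p m / 2" "w / 2" "snd p" m] s w by simp
  also have "2 * snd p * (dp2 \<sigma> p m / 2) - 4 * (w / 2) * of_nat (Suc m) / (1 - w\<^sup>2) =
      - snd p * dp2 \<sigma> p (Suc (Suc m))"
    using s w by (simp add: w_def[symmetric] field_simps)
  finally show ?case by (simp add: param_def w_def)
qed

text \<open>A generic point is moved down one level and approximated there; the same parameters are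
  then used one level up. They converge to the original point because the map back is continuous
  where \<open>s \<noteq> 0\<close> and 4 \<chi>^2 \<noteq> 1, and there they eventually satisfy the
  additional condition of the larger domain.\<close>

lemma param_dense:
  assumes \<sigma>: "\<sigma>\<^sup>2 = 1"
  shows "det_surface \<sigma> l \<subseteq> closure (param \<sigma> l ` param_dom \<sigma> l)"
proof (induction l)
  case 0
  show ?case
  proof (clarify, unfold closure_approachable, intro allI impI)
    fix \<chi> a s :: complex and e :: real
    assume p: "(\<chi>, a, s) \<in> det_surface \<sigma> 0" and e: "e > 0"
    obtain t where t: "norm t < e" "t \<noteq> - s"
      using ball_avoid_finite[of "{- s}" e] e by auto
    define s' where "s' = s + t"
    have s: "s' \<noteq> 0" using t by (auto simp: s'_def add_eq_0_iff)
    \<comment> \<open>At level 0 the second coordinate of \<open>param\<close> is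
      \<open>- s'\<close> times the first parameter, which dictates this choice.\<close>
    have "param \<sigma> 0 (- a / s', s') = (\<chi>, a, s')"
      using p s by (simp add: param_def det_surface_0[OF \<sigma>])
    moreover have "(- a / s', s') \<in> param_dom \<sigma> 0"
      using s by (simp add: param_dom_def)
    moreover have "dist (\<chi>, a, s') (\<chi>, a, s) < e"
      using t by (simp add: dist_Pair_Pair dist_norm s'_def)
    ultimately show "\<exists>y\<in>param \<sigma> 0 ` param_dom \<sigma> 0. dist y (\<chi>, a, s) < e"
      by (metis imageI)
  qed
next
  case (Suc m)
  let ?C = "closure (param \<sigma> (Suc m) ` param_dom \<sigma> (Suc m))"
  have "{(\<chi>, a, s). (\<chi>, a, s) \<in> det_surface \<sigma> (Suc m) \<and> s \<noteq> 0 \<and> 4 * \<chi>\<^sup>2 \<noteq> 1} \<subseteq> ?C"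
  proof clarify
    fix \<chi> a s :: complex
    assume p: "(\<chi>, a, s) \<in> det_surface \<sigma> (Suc m)" and s: "s \<noteq> 0" and \<chi>: "4 * \<chi>\<^sup>2 \<noteq> 1"
    define \<chi>' where "\<chi>' = (a / 2 + 2 * \<chi> * of_nat (Suc m) / (1 - 4 * \<chi>\<^sup>2)) / s"
    have "(\<chi>', - 2 * \<chi> * s, s) \<in> closure (param \<sigma> m ` param_dom \<sigma> m)"
      using det_surface_step[OF \<sigma> p s \<chi>] Suc.IH unfolding \<chi>'_def by blast
    then obtain y where y: "\<And>n. y n \<in> param \<sigma> m ` param_dom \<sigma> m" "y \<longlonglongrightarrow> (\<chi>', - 2 * \<chi> * s, s)"
      unfolding closure_sequential by blast
    then have "\<forall>n. \<exists>p. p \<in> param_dom \<sigma> m \<and> y n = param \<sigma> m p" by blast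
    then obtain q where q: "\<And>n. q n \<in> param_dom \<sigma> m" "\<And>n. y n = param \<sigma> m (q n)"
      using choice[of "\<lambda>n p. p \<in> param_dom \<sigma> m \<and> y n = param \<sigma> m p"] by blast
    have lim: "(\<lambda>n. dp2 \<sigma> (q n) m / 2) \<longlonglongrightarrow> \<chi>'" "(\<lambda>n. - snd (q n) * dp2 \<sigma> (q n) (Suc m)) \<longlonglongrightarrow> - 2 * \<chi> * s"
      "(\<lambda>n. snd (q n)) \<longlonglongrightarrow> s"
      using tendsto_fst[OF y(2)] tendsto_fst[OF tendsto_snd[OF y(2)]] tendsto_snd[OF tendsto_snd[OF y(2)]]
      by (simp_all add: q(2) param_def)
    have s_n: "snd (q n) \<noteq> 0" for n using q(1)[of n] by (simp add: param_dom_def)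
    have lim_m: "(\<lambda>n. dp2 \<sigma> (q n) m) \<longlonglongrightarrow> 2 * \<chi>'"
      using tendsto_mult_left[OF lim(1), of 2] by simp
    have "(\<lambda>n. - (- snd (q n) * dp2 \<sigma> (q n) (Suc m)) / snd (q n)) \<longlonglongrightarrow> - (- 2 * \<chi> * s) / s"
      by (intro tendsto_intros lim s)
    then have lim_Suc: "(\<lambda>n. dp2 \<sigma> (q n) (Suc m)) \<longlonglongrightarrow> 2 * \<chi>"
      using s s_n by simp
    have \<chi>2: "(2 * \<chi>)\<^sup>2 \<noteq> 1" "1 - 4 * \<chi>\<^sup>2 \<noteq> 0" using \<chi> by (auto simp: power_mult_distrib)
    have "(\<lambda>n. (dp2 \<sigma> (q n) (Suc m))\<^sup>2) \<longlonglongrightarrow> (2 * \<chi>)\<^sup>2"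
      by (intro tendsto_intros lim_Suc)
    then have "\<forall>\<^sub>F n in sequentially. (dp2 \<sigma> (q n) (Suc m))\<^sup>2 \<noteq> 1"
      using \<chi>2(1) by (rule tendsto_imp_eventually_ne)
    then have ev: "\<forall>\<^sub>F n in sequentially. param \<sigma> (Suc m) (q n) \<in> ?C"
      by eventually_elim (use q(1) in \<open>auto simp: param_dom_Suc intro!: closure_subset[THEN subsetD]\<close>)
    have "(\<lambda>n. - snd (q n) * (2 * of_nat (Suc m) * dp2 \<sigma> (q n) (Suc m) /
          (snd (q n) * (1 - (dp2 \<sigma> (q n) (Suc m))\<^sup>2)) - dp2 \<sigma> (q n) m)) \<longlonglongrightarrow>
        - s * (2 * of_nat (Suc m) * (2 * \<chi>) / (s * (1 - (2 * \<chi>)\<^sup>2)) - 2 * \<chi>')"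
      using \<chi>2(1) s by (intro tendsto_intros lim lim_Suc lim_m) auto
    also have "- s * (2 * of_nat (Suc m) * (2 * \<chi>) / (s * (1 - (2 * \<chi>)\<^sup>2)) - 2 * \<chi>') =
        2 * (s * \<chi>') - 4 * \<chi> * of_nat (Suc m) / (1 - 4 * \<chi>\<^sup>2)"
    proof -
      define Y where "Y = 4 * \<chi> * of_nat (Suc m) / (1 - 4 * \<chi>\<^sup>2)"
      have "2 * of_nat (Suc m) * (2 * \<chi>) / (s * (1 - (2 * \<chi>)\<^sup>2)) = Y / s"
        by (simp add: Y_def power_mult_distrib mult_ac)
      moreover have "- s * (Y / s - 2 * \<chi>') = 2 * (s * \<chi>') - Y"
        using s by (simp add: right_diff_distrib)
      ultimately show ?thesis by (simp only: Y_def)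
    qed
    also have "s * \<chi>' = a / 2 + 2 * \<chi> * of_nat (Suc m) / (1 - 4 * \<chi>\<^sup>2)"
      using s by (simp add: \<chi>'_def)
    also have "2 * (a / 2 + 2 * \<chi> * of_nat (Suc m) / (1 - 4 * \<chi>\<^sup>2)) - 4 * \<chi> * of_nat (Suc m) / (1 - 4 * \<chi>\<^sup>2) = a"
      by (simp add: algebra_simps)
    finally have lim_a: "(\<lambda>n. - snd (q n) * dp2 \<sigma> (q n) (Suc (Suc m))) \<longlonglongrightarrow> a" by simp
    have "(\<lambda>n. dp2 \<sigma> (q n) (Suc m) / 2) \<longlonglongrightarrow> \<chi>"
      using tendsto_divide[OF lim_Suc tendsto_const[of 2]] by simp
    then have "(\<lambda>n. param \<sigma> (Suc m) (q n)) \<longlonglongrightarrow> (\<chi>, a, s)"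
      unfolding param_def by (intro tendsto_Pair lim_a lim)
    then show "(\<chi>, a, s) \<in> ?C"
      using Lim_in_closed_set[OF closed_closure ev] by simp
  qed
  then have "closure {(\<chi>, a, s). (\<chi>, a, s) \<in> det_surface \<sigma> (Suc m) \<and> s \<noteq> 0 \<and> 4 * \<chi>\<^sup>2 \<noteq> 1} \<subseteq> ?C"
    by (rule closure_minimal) simp
  then show ?case
    using det_surface_generic_dense[OF \<sigma>, of "Suc m"] by simp
qed

text \<open>By density it suffices that the surface has a point. The origin is one, since the first
  column of the matrix vanishes there; no explicit parameter has to be followed through the
  recurrence.\<close>

lemma param_dom_nonempty:
  assumes \<sigma>: "\<sigma>\<^sup>2 = 1" and l: "1 \<le> l"
  shows "param_dom \<sigma> l \<noteq> {}"
proof -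
  have "kernel_rel \<sigma> l 0 0 0 (\<lambda>i. if i = 0 then 1 else 0)"
    using l by (simp add: kernel_rel_def refl_comb_def)
  then have "(0, 0, 0) \<in> det_surface \<sigma> l"
    unfolding det_surface_iff[OF \<sigma>] by (intro exI conjI) auto
  then show ?thesis using param_dense[OF \<sigma>, of l] by auto
qed

section \<open>Rationality\<close>

definition affine2 :: "complex \<times> complex \<Rightarrow> complex vec" where
  "affine2 p = vec_of_list [1, fst p, snd p]"

definition affine3 :: "complex \<times> complex \<times> complex \<Rightarrow> complex vec" where
  "affine3 p = vec_of_list [1, fst p, fst (snd p), snd (snd p)]"

lemma affine2_index: "i \<le> 2 \<Longrightarrow> affine2 p $ i = [1, fst p, snd p] ! i"
  by (simp add: affine2_def vec_of_list_index del: vec_of_list_Cons)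

lemma affine3_index: "i \<le> 3 \<Longrightarrow> affine3 p $ i = [1, fst p, fst (snd p), snd (snd p)] ! i"
  by (simp add: affine3_def vec_of_list_index del: vec_of_list_Cons)

lemma affine2_carrier: "affine2 p \<in> carrier_vec (Suc 2)"
  unfolding affine2_def by (rule carrier_vecI) (simp del: vec_of_list_Cons)

lemma affine3_carrier: "affine3 p \<in> carrier_vec (Suc 3)"
  unfolding affine3_def by (rule carrier_vecI) (simp del: vec_of_list_Cons)

lemma affine2_nonzero: "affine2 p \<in> nonzero_vec 2"
proof -
  have "affine2 p $ 0 \<noteq> 0\<^sub>v (Suc 2) $ 0" by (simp add: affine2_index)
  then show ?thesis using affine2_carrier by (auto simp: nonzero_vec_def)
qed

lemma affine3_nonzero: "affine3 p \<in> nonzero_vec 3"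
proof -
  have "affine3 p $ 0 \<noteq> 0\<^sub>v (Suc 3) $ 0" by (simp add: affine3_index)
  then show ?thesis using affine3_carrier by (auto simp: nonzero_vec_def)
qed

lemma affine_embedding_eq: "affine_embedding p = hpoint (affine3 p)"
  by (simp add: affine_embedding_def affine3_def case_prod_unfold)

lemma form_zero_on_closure:
  assumes F: "form 3 d F" and G: "\<And>p. p \<in> G \<Longrightarrow> F (affine3 p) = 0" and p: "p \<in> closure G"
  shows "F (affine3 p) = 0"
proof -
  have "continuous_on UNIV (\<lambda>p. affine3 p $ i)" if "i \<le> 3" for i
  proof -
    have "i = 0 \<or> i = 1 \<or> i = 2 \<or> i = 3" using that by auto
    then show ?thesis by (auto simp: affine3_index intro!: continuous_intros)
  qed
  then have "continuous_on UNIV (\<lambda>p. F (affine3 p))"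
    by (intro continuous_form[OF F] affine3_carrier)
  then have "closed {p. F (affine3 p) = 0}"
    by (intro closed_Collect_eq continuous_on_const)
  then have "closure G \<subseteq> {p. F (affine3 p) = 0}"
    by (intro closure_minimal) (use G in auto)
  then show ?thesis using p by blast
qed

text \<open>Euclidean density suffices: the zero set of a form is closed, so the same forms vanish
  on \<open>G\<close> and on \<open>S\<close>.\<close>

lemma projective_closure_dense:
  assumes "G \<subseteq> S" "S \<subseteq> closure G"
  shows "projective_closure S = zariski_closure 3 (hpoint ` affine3 ` G)"
proof -
  have "projective_closure S = zariski_closure 3 (hpoint ` affine3 ` S)"
    unfolding projective_closure_def image_image affine_embedding_eq ..
  also have "\<dots> = zero_locus 3 {F. (\<exists>d. form 3 d F) \<and> (\<forall>v\<in>affine3 ` S. F v = 0)}"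
    by (rule zariski_closure_hpoints) (use affine3_nonzero in auto)
  also have "{F. (\<exists>d. form 3 d F) \<and> (\<forall>v\<in>affine3 ` S. F v = 0)} =
      {F. (\<exists>d. form 3 d F) \<and> (\<forall>v\<in>affine3 ` G. F v = 0)}"
  proof (intro Collect_cong conj_cong refl)
    fix F assume "\<exists>d. form 3 d F"
    then show "(\<forall>v\<in>affine3 ` S. F v = 0) \<longleftrightarrow> (\<forall>v\<in>affine3 ` G. F v = 0)"
      using assms form_zero_on_closure[of _ F G] by blast
  qed
  also have "zero_locus 3 \<dots> = zariski_closure 3 (hpoint ` affine3 ` G)"
    by (rule zariski_closure_hpoints[symmetric]) (use affine3_nonzero in auto)
  finally show ?thesis .
qed

section \<open>Parameters and surface coordinates as rational functions of each other\<close>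

lemma form_ratio_affine2:
  "form_ratio 2 affine2 U fst" "form_ratio 2 affine2 U snd"
  using form_ratio_coord[of 1 2 U affine2] form_ratio_coord[of 2 2 U affine2]
  by (simp_all add: affine2_index)

lemma form_ratio_dp2:
  "k \<le> Suc l \<Longrightarrow> form_ratio 2 affine2 (param_dom \<sigma> l) (\<lambda>p. dp2 \<sigma> p k)"
proof (induction k rule: induct_nat_012)
  case (ge2 k)
  then have "(dp2 \<sigma> p (Suc k))\<^sup>2 \<noteq> 1 \<and> snd p \<noteq> 0" if "p \<in> param_dom \<sigma> l" for p
    using that by (simp add: param_dom_def)
  then show ?case
    using ge2 unfolding dp2.simps by (intro form_ratio_intros form_ratio_affine2) auto
qed (auto intro: form_ratio_intros form_ratio_affine2)

text \<open>The domain is a principal open set. With \<open>dp2 \<sigma> p (Suc m) = N / M\<close>,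
  the new condition is that N^2 - M^2 is nonzero; this quotient is only meaningful where
  \<open>B\<close> is nonzero, and the factor \<open>B\<close> removes the other points.\<close>

lemma param_dom_form:
  "\<exists>d B. form 2 d B \<and> (\<forall>p. p \<in> param_dom \<sigma> l \<longleftrightarrow> B (affine2 p) \<noteq> 0)"
proof (induction l)
  case 0
  show ?case
    using form_coord[of 2 2] by (intro exI conjI) (auto simp: param_dom_def affine2_index)
next
  case (Suc m)
  obtain d B where B: "form 2 d B" "\<And>p. p \<in> param_dom \<sigma> m \<longleftrightarrow> B (affine2 p) \<noteq> 0"
    using Suc by blast
  obtain e N M where NM: "form 2 e N" "form 2 e M" "\<And>p. p \<in> param_dom \<sigma> m \<Longrightarrow> M (affine2 p) \<noteq> 0"
    "\<And>p. p \<in> param_dom \<sigma> m \<Longrightarrow> dp2 \<sigma> p (Suc m) = N (affine2 p) / M (affine2 p)"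
    using form_ratioE[OF form_ratio_dp2[of "Suc m" m \<sigma>]] by auto
  have "form 2 (d + (e + e)) (\<lambda>v. B v * (N v * N v - M v * M v))"
    by (intro form_mult form_diff B NM)
  moreover have "p \<in> param_dom \<sigma> (Suc m) \<longleftrightarrow>
      B (affine2 p) * (N (affine2 p) * N (affine2 p) - M (affine2 p) * M (affine2 p)) \<noteq> 0" for p
  proof (cases "p \<in> param_dom \<sigma> m")
    case True
    then show ?thesis
      using NM(3,4)[OF True] B(2)[of p] by (simp add: param_dom_Suc power_divide power2_eq_square)
  qed (use B(2)[of p] in \<open>auto simp: param_dom_Suc\<close>)
  ultimately show ?case by blast
qed

text \<open>A nonempty principal open set is Zariski dense: the product of \<open>F\<close>,
  \<open>B\<close> and the coordinate \<open>x $ 0\<close> vanishes everywhere, the last factor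
  taking care of the line at infinity, and the product of the last two is not identically
  zero.\<close>

lemma form_zero_of_param_dom:
  assumes F: "form 2 d F" and zero: "\<And>p. p \<in> param_dom \<sigma> l \<Longrightarrow> F (affine2 p) = 0"
    and ne: "param_dom \<sigma> l \<noteq> {}" and v: "v \<in> carrier_vec (Suc 2)"
  shows "F v = 0"
proof (rule ccontr)
  assume "F v \<noteq> 0"
  obtain e B where B: "form 2 e B" "\<And>p. p \<in> param_dom \<sigma> l \<longleftrightarrow> B (affine2 p) \<noteq> 0"
    using param_dom_form by blast
  have B0: "form 2 (e + 1) (\<lambda>v. B v * v $ 0)"
    by (intro form_mult form_coord B) simp
  have "F x * (B x * x $ 0) = 0" if x: "x \<in> carrier_vec (Suc 2)" for x
  proof (cases "x $ 0 = 0")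
    case False
    define p where "p = (x $ 1 / x $ 0, x $ 2 / x $ 0)"
    have "x = x $ 0 \<cdot>\<^sub>v affine2 p"
    proof (rule eq_vecI)
      fix i assume "i < dim_vec (x $ 0 \<cdot>\<^sub>v affine2 p)"
      then have i: "i < dim_vec (affine2 p)" "i \<le> 2" using carrier_vecD[OF affine2_carrier[of p]] by auto
      then have "i = 0 \<or> i = 1 \<or> i = 2" by auto
      then show "x $ i = (x $ 0 \<cdot>\<^sub>v affine2 p) $ i"
        using False i by (auto simp: p_def affine2_index)
    qed (use x carrier_vecD[OF affine2_carrier[of p]] in auto)
    then have "F x = (x $ 0) ^ d * F (affine2 p)" "B x = (x $ 0) ^ e * B (affine2 p)"
      using form_smult_vec[OF F affine2_carrier] form_smult_vec[OF B(1) affine2_carrier] by metis+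
    then show ?thesis using zero[of p] B(2)[of p] by auto
  qed simp
  then have B_zero: "B x * x $ 0 = 0" if "x \<in> carrier_vec (Suc 2)" for x
    using form_mult_eq_0D[OF F B0 _ v \<open>F v \<noteq> 0\<close> that] by blast
  obtain p where "p \<in> param_dom \<sigma> l" using ne by blast
  then show False
    using B_zero[OF affine2_carrier, of p] B(2)[of p] by (simp add: affine2_index)
qed

text \<open>The recurrence runs backwards too, so \<open>\<chi>\<close>, \<open>a\<close> and \<open>s\<close> determine the parameters rationally.\<close>
lemma form_ratio_dp2_back:
  assumes "k \<le> l"
  shows "form_ratio 3 (\<lambda>p. affine3 (param \<sigma> l p)) (param_dom \<sigma> l) (\<lambda>p. dp2 \<sigma> p (l - k)) \<and>
    form_ratio 3 (\<lambda>p. affine3 (param \<sigma> l p)) (param_dom \<sigma> l) (\<lambda>p. dp2 \<sigma> p (Suc (l - k)))"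
    (is "?R (\<lambda>p. dp2 \<sigma> p (l - k)) \<and> _")
proof -
  have coord: "?R (\<lambda>p. dp2 \<sigma> p l / 2)" "?R (\<lambda>p. - snd p * dp2 \<sigma> p (Suc l))" "?R snd"
    using form_ratio_coord[of 1 3 "param_dom \<sigma> l" "\<lambda>p. affine3 (param \<sigma> l p)"]
      form_ratio_coord[of 2 3 "param_dom \<sigma> l" "\<lambda>p. affine3 (param \<sigma> l p)"]
      form_ratio_coord[of 3 3 "param_dom \<sigma> l" "\<lambda>p. affine3 (param \<sigma> l p)"]
    by (simp_all add: affine3_index param_def)
  have s: "snd p \<noteq> 0" if "p \<in> param_dom \<sigma> l" for p using that by (simp add: param_dom_def)
  show ?thesis
    using assms
  proof (induction k)
    case 0
    have 1: "?R (\<lambda>p. 2 * (dp2 \<sigma> p l / 2))"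
      by (intro form_ratio_intros coord)
    have 2: "?R (\<lambda>p. - snd p * dp2 \<sigma> p (Suc l) / (- snd p))"
      by (intro form_ratio_intros coord) (use s in simp)
    have "?R (\<lambda>p. dp2 \<sigma> p l)" by (rule form_ratio_cong[OF 1]) simp
    moreover have "?R (\<lambda>p. dp2 \<sigma> p (Suc l))" by (rule form_ratio_cong[OF 2]) (use s in simp)
    ultimately show ?case by simp
  next
    case (Suc k)
    define j where "j = l - Suc k"
    have j: "l - k = Suc j" "Suc j \<le> l" using Suc.prems by (auto simp: j_def)
    have IH: "?R (\<lambda>p. dp2 \<sigma> p (Suc j))" "?R (\<lambda>p. dp2 \<sigma> p (Suc (Suc j)))"
      using Suc j by auto
    have w: "(dp2 \<sigma> p (Suc j))\<^sup>2 \<noteq> 1" if "p \<in> param_dom \<sigma> l" for p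
      using that j by (simp add: param_dom_def)
    \<comment> \<open>The recurrence is symmetric in its outer terms, so the same expression gives
      the earlier value from the two later ones.\<close>
    have "?R (\<lambda>p. 2 * of_nat (Suc j) * dp2 \<sigma> p (Suc j) / (snd p * (1 - (dp2 \<sigma> p (Suc j))\<^sup>2))
        - dp2 \<sigma> p (Suc (Suc j)))"
      using s w by (intro form_ratio_intros IH coord) auto
    then have "?R (\<lambda>p. dp2 \<sigma> p j)" by simp
    then show ?case using IH j_def by simp
  qed
qed

lemma rational_surface_det_surface:
  assumes \<sigma>: "\<sigma>\<^sup>2 = 1" and l: "1 \<le> l"
  shows "rational_surface 3 (projective_closure (det_surface \<sigma> l))"
proof -
  let ?U = "param_dom \<sigma> l" and ?\<eta> = "\<lambda>p. affine3 (param \<sigma> l p)"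
  note ne = param_dom_nonempty[OF \<sigma> l]
  have ratio3: "form_ratio 2 affine2 ?U (\<lambda>p. [1, dp2 \<sigma> p l / 2, - snd p * dp2 \<sigma> p (Suc l), snd p] ! i)"
    if "i \<le> 3" for i
  proof -
    have "i = 0 \<or> i = 1 \<or> i = 2 \<or> i = 3" using that by auto
    then show ?thesis
      by (auto intro!: form_ratio_intros form_ratio_affine2 form_ratio_dp2 simp del: dp2.simps)
  qed
  obtain e \<Psi> where \<Psi>: "\<forall>i\<le>3. form 2 e (\<lambda>v. \<Psi> v $ i)" "\<forall>v. \<Psi> v \<in> carrier_vec (Suc 3)"
      "\<forall>p\<in>?U. \<exists>c. c \<noteq> 0 \<and> \<Psi> (affine2 p) = c \<cdot>\<^sub>v Matrix.vec (Suc 3)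
        (\<lambda>i. [1, dp2 \<sigma> p l / 2, - snd p * dp2 \<sigma> p (Suc l), snd p] ! i)"
    using form_ratio_tuple[of 3 2 affine2 ?U "\<lambda>i p. [1, dp2 \<sigma> p l / 2, - snd p * dp2 \<sigma> p (Suc l), snd p] ! i"] ratio3 by blast
  have ratio2: "form_ratio 3 ?\<eta> ?U (\<lambda>p. [1, fst p, snd p] ! i)" if "i \<le> 2" for i
  proof -
    have "i = 0 \<or> i = 1 \<or> i = 2" using that by auto
    moreover have "form_ratio 3 ?\<eta> ?U fst"
      \<comment> \<open>Going back \<open>l - 1\<close> steps reaches index 1, where
        \<open>dp2\<close> is the first parameter.\<close>
      using form_ratio_dp2_back[of "l - 1" l \<sigma>] l by (auto elim: form_ratio_cong)
    moreover have "form_ratio 3 ?\<eta> ?U snd"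
      using form_ratio_coord[of 3 3 ?U ?\<eta>] by (simp add: affine3_index param_def)
    ultimately show ?thesis by (auto intro: form_ratio_const)
  qed
  obtain d \<Phi> where \<Phi>: "\<forall>i\<le>2. form 3 d (\<lambda>v. \<Phi> v $ i)" "\<forall>v. \<Phi> v \<in> carrier_vec (Suc 2)"
      "\<forall>p\<in>?U. \<exists>c. c \<noteq> 0 \<and> \<Phi> (?\<eta> p) = c \<cdot>\<^sub>v Matrix.vec (Suc 2) (\<lambda>i. [1, fst p, snd p] ! i)"
    using form_ratio_tuple[of 2 3 ?\<eta> ?U "\<lambda>i p. [1, fst p, snd p] ! i"] ratio2 by blast
  have vec2: "Matrix.vec (Suc 2) (\<lambda>i. [1, fst p, snd p] ! i) = affine2 p" for p :: "complex \<times> complex"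
    by (rule eq_vecI) (auto simp: affine2_def vec_of_list_index simp del: vec_of_list_Cons)
  have vec3: "Matrix.vec (Suc 3) (\<lambda>i. [1, dp2 \<sigma> p l / 2, - snd p * dp2 \<sigma> p (Suc l), snd p] ! i) = ?\<eta> p" for p
    by (rule eq_vecI) (auto simp: affine3_def param_def vec_of_list_index simp del: vec_of_list_Cons)
  have "rational_surface 3 (zariski_closure 3 (hpoint ` ?\<eta> ` ?U))"
  proof (rule rational_surface_of_param[of ?U affine2 ?\<eta> 3 d \<Phi> e \<Psi>])
    show "F v = 0" if "form 2 d F" "\<And>u. u \<in> ?U \<Longrightarrow> F (affine2 u) = 0" "v \<in> carrier_vec (Suc 2)" for d F v
      using form_zero_of_param_dom[OF that(1,2) ne that(3)] by blast
  qed (use ne affine2_nonzero affine3_nonzero \<Phi>[unfolded vec2] \<Psi>[unfolded vec3] in blast)+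
  also have "zariski_closure 3 (hpoint ` ?\<eta> ` ?U) = projective_closure (det_surface \<sigma> l)"
    using projective_closure_dense[of "param \<sigma> l ` ?U" "det_surface \<sigma> l"]
      param_in_det_surface[OF \<sigma>, of _ l] param_dense[OF \<sigma>, of l]
    by (simp add: image_image image_subset_iff)
  finally show ?thesis .
qed

theorem corollary1p15:
  fixes l :: nat
  assumes "l \<ge> 1"
  shows "rational_surface 3 (projective_closure (S_plus l)) \<and>
         rational_surface 3 (projective_closure (S_minus l))"
  unfolding S_plus_eq S_minus_eq
  using rational_surface_det_surface[of 1 l] rational_surface_det_surface[of "-1" l] assms by simp

end
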